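(* Let $f\in\mathcal C^2[0,\pi]$, $\beta>0$, $\gamma>-1$, and let $N\in\mathbb N$ be given. For $r\in\mathbb N$, let $h_r=\pi/(2rN)$, $\tilde s_n=h_r n$ and $\tilde s_{n+1/2}=h_r(n+1/2)$ (so that $\tilde s_0,\ldots,\tilde s_{2rN}$ divide $[0,\pi]$ into $2rN$ subintervals of equal length), and let $s_j=\frac{(2j+1)\pi}{2N}$ for $j\in\{0,\ldots,N-1\}$. Let $$I(s_j)=\int_0^\pi \sin^\beta(\eta)\,|\sin(\eta-s_j)|^\gamma f(\eta)\,d\eta,$$ and define $$A_{1,j}=\frac1{h_r}\sum_{n=0}^{rN-1}\left(\frac{\sin(\tilde s_{n+1/2})}{\tilde s_{n+1/2}}\right)^\beta\left(\frac{\sin(\tilde s_{n+1/2}-s_j)}{\tilde s_{n+1/2}-s_j}\right)^\gamma\frac{\tilde s_{n+1}^{\beta+1}-\tilde s_n^{\beta+1}}{\beta+1}\cdot\frac{\operatorname{sgn}(\tilde s_{n+1}-s_j)|\tilde s_{n+1}-s_j|^{\gamma+1}-\operatorname{sgn}(\tilde s_n-s_j)|\tilde s_n-s_j|^{\gamma+1}}{\gamma+1}\,f(\tilde s_{n+1/2}),$$ $$A_{2,j}=\frac1{h_r}\sum_{n=rN}^{2rN-1}\left(\frac{\sin(\tilde s_{n+1/2})}{\pi-\tilde s_{n+1/2}}\right)^\beta\left(\frac{\sin(\tilde s_{n+1/2}-s_j)}{\tilde s_{n+1/2}-s_j}\right)^\gamma\frac{(\pi-\tilde s_n)^{\beta+1}-(\pi-\tilde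 s_{n+1})^{\beta+1}}{\beta+1}\cdot\frac{\operatorname{sgn}(\tilde s_{n+1}-s_j)|\tilde s_{n+1}-s_j|^{\gamma+1}-\operatorname{sgn}(\tilde s_n-s_j)|\tilde s_n-s_j|^{\gamma+1}}{\gamma+1}\,f(\tilde s_{n+1/2}).$$ Then there is a constant $K>0$, independent of $r$ and $j$, such that, for all $r\in\mathbb N$ and all $j\in\{0,\ldots,N-1\}$, the numerical error $E_j=I(s_j)-A_{1,j}-A_{2,j}$ satisfies $$|E_j|\le\frac{K}{r^2}.$$
   Context: $\mathbb N=\{1,2,3,\ldots\}$. The function $\operatorname{sgn}$ is the sign function, with $\operatorname{sgn}(0)=0$. *)

theory Defs
  imports "HOL-Analysis.Analysis"
begin

(* Derivatives are taken within the interval, hence one-sided at the endpoints. *)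
definition C2_on :: "real \<Rightarrow> real \<Rightarrow> (real \<Rightarrow> real) \<Rightarrow> bool" where
  "C2_on a b f \<longleftrightarrow>
     (\<exists>f' f''. (\<forall>x\<in>{a..b}. (f has_real_derivative f' x) (at x within {a..b})) \<and>
              (\<forall>x\<in>{a..b}. (f' has_real_derivative f'' x) (at x within {a..b})) \<and>
              continuous_on {a..b} f'')"

definition mesh_width :: "nat \<Rightarrow> nat \<Rightarrow> real" where
  "mesh_width N r = pi / (2 * real r * real N)"

(* The position is a real number so that midpoints are covered as well:
   position n is a grid point, position n + 1/2 a midpoint. *)
definition mesh_point :: "nat \<Rightarrow> nat \<Rightarrow> real \<Rightarrow> real" where
  "mesh_point N r x = mesh_width N r * x"

definition colloc_point :: "nat \<Rightarrow> nat \<Rightarrow> real" where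
  "colloc_point N j = (2 * real j + 1) * pi / (2 * real N)"

(* Since 0 powr c = 0, the integrand takes the value 0 at \<eta> = s when \<gamma> \<le> 0;
   a single point does not affect the integral. *)
definition sing_integral :: "real \<Rightarrow> real \<Rightarrow> (real \<Rightarrow> real) \<Rightarrow> real \<Rightarrow> real" where
  "sing_integral \<beta> \<gamma> f s =
     integral {0..pi} (\<lambda>\<eta>. sin \<eta> powr \<beta> * \<bar>sin (\<eta> - s)\<bar> powr \<gamma> * f \<eta>)"

(* Every mid - s occurring below is nonzero with absolute value less than pi, because
   the collocation points s are grid points in the open interval (0, pi). Hence no
   division by zero occurs and all bases of powr are nonnegative. *)
definition quad_left ::
    "real \<Rightarrow> real \<Rightarrow> (real \<Rightarrow> real) \<Rightarrow> nat \<Rightarrow> nat \<Rightarrow> nat \<Rightarrow> real" where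
  "quad_left \<beta> \<gamma> f N r j =
     1 / mesh_width N r *
     (\<Sum>n = 0..<r * N.
        let s = colloc_point N j;
            lo = mesh_point N r (real n);
            mid = mesh_point N r (real n + 1 / 2);
            hi = mesh_point N r (real n + 1)
        in (sin mid / mid) powr \<beta>
           * (sin (mid - s) / (mid - s)) powr \<gamma>
           * ((hi powr (\<beta> + 1) - lo powr (\<beta> + 1)) / (\<beta> + 1))
           * ((sgn (hi - s) * \<bar>hi - s\<bar> powr (\<gamma> + 1)
               - sgn (lo - s) * \<bar>lo - s\<bar> powr (\<gamma> + 1)) / (\<gamma> + 1))
           * f mid)"

definition quad_right ::
    "real \<Rightarrow> real \<Rightarrow> (real \<Rightarrow> real) \<Rightarrow> nat \<Rightarrow> nat \<Rightarrow> nat \<Rightarrow> real" where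
  "quad_right \<beta> \<gamma> f N r j =
     1 / mesh_width N r *
     (\<Sum>n = r * N..<2 * r * N.
        let s = colloc_point N j;
            lo = mesh_point N r (real n);
            mid = mesh_point N r (real n + 1 / 2);
            hi = mesh_point N r (real n + 1)
        in (sin mid / (pi - mid)) powr \<beta>
           * (sin (mid - s) / (mid - s)) powr \<gamma>
           * (((pi - lo) powr (\<beta> + 1) - (pi - hi) powr (\<beta> + 1)) / (\<beta> + 1))
           * ((sgn (hi - s) * \<bar>hi - s\<bar> powr (\<gamma> + 1)
               - sgn (lo - s) * \<bar>lo - s\<bar> powr (\<gamma> + 1)) / (\<gamma> + 1))
           * f mid)"

definition quad_error ::
    "real \<Rightarrow> real \<Rightarrow> (real \<Rightarrow> real) \<Rightarrow> nat \<Rightarrow> nat \<Rightarrow> nat \<Rightarrow> real" where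
  "quad_error \<beta> \<gamma> f N r j =
     sing_integral \<beta> \<gamma> f (colloc_point N j)
       - quad_left \<beta> \<gamma> f N r j - quad_right \<beta> \<gamma> f N r j"

end

theory Submission
  imports Defs
begin

text \<open>
  Write the integrand as \<open>U V G\<close> with \<open>U\<close> the power of the distance to the nearer endpoint,
  \<open>V = \<bar>\<eta> - s\<bar>\<^sup>\<gamma>\<close>, and \<open>G\<close> of class \<open>C\<^sup>2\<close> on each half of \<open>[0, \<pi>]\<close>. On a cell with midpoint \<open>m\<close>,
  Taylor expansion of the factors other than the weight leaves a remainder \<open>O(h\<^sup>2)\<close> times the integral
  of the weight, and a first-order term, a multiple of the integral of \<open>(\<eta> - m)\<close> against the weight.
  Away from \<open>s\<close> the weight is \<open>U\<close>, which is monotone on each half, so the first-order terms are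
  bounded by \<open>h\<^sup>2\<close> times its total variation. Near \<open>s\<close> the weight is \<open>V\<close>; when \<open>\<gamma> < 0\<close> the
  first-order terms alone sum only to \<open>O(h\<^bsup>2+\<gamma>\<^esup>)\<close>. But \<open>V\<close> is symmetric about the grid point \<open>s\<close>, so
  the moments of mirror cells cancel and only the difference of \<open>F' = (U G)'\<close> at mirror midpoints
  survives; this gains a factor \<open>\<bar>m - s\<bar>\<close>, which restores \<open>O(h\<^sup>2)\<close>. The kink of \<open>U\<close> at \<open>\<pi>/2\<close> is
  harmless even when \<open>s = \<pi>/2\<close>, because \<open>F = sin\<^sup>\<beta> \<cdot> \<dots>\<close> is smooth there.
\<close>

section \<open>Twice continuously differentiable functions\<close>

lemma C2_onI:
  assumes "\<And>x. x \<in> {a..b} \<Longrightarrow> (f has_real_derivative f' x) (at x within {a..b})"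
    and "\<And>x. x \<in> {a..b} \<Longrightarrow> (f' has_real_derivative f'' x) (at x within {a..b})"
    and "continuous_on {a..b} f''"
  shows "C2_on a b f"
  unfolding C2_on_def using assms by blast

lemma C2_onE:
  assumes "C2_on a b f"
  obtains f' f'' where
    "\<And>x. x \<in> {a..b} \<Longrightarrow> (f has_real_derivative f' x) (at x within {a..b})"
    "\<And>x. x \<in> {a..b} \<Longrightarrow> (f' has_real_derivative f'' x) (at x within {a..b})"
    "continuous_on {a..b} f" "continuous_on {a..b} f'" "continuous_on {a..b} f''"
proof -
  obtain f' f'' where *:
    "\<And>x. x \<in> {a..b} \<Longrightarrow> (f has_real_derivative f' x) (at x within {a..b})"
    "\<And>x. x \<in> {a..b} \<Longrightarrow> (f' has_real_derivative f'' x) (at x within {a..b})"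
    "continuous_on {a..b} f''"
    using assms unfolding C2_on_def by blast
  have "continuous_on {a..b} f" "continuous_on {a..b} f'"
    using *(1,2) DERIV_continuous_on by blast+
  with * show thesis using that by blast
qed

lemma C2_on_continuous_on: "C2_on a b f \<Longrightarrow> continuous_on {a..b} f"
  by (erule C2_onE)

lemma C2_on_subset:
  assumes "C2_on a b f" "a \<le> c" "d \<le> b"
  shows "C2_on c d f"
proof -
  obtain f' f'' where *:
    "\<And>x. x \<in> {a..b} \<Longrightarrow> (f has_real_derivative f' x) (at x within {a..b})"
    "\<And>x. x \<in> {a..b} \<Longrightarrow> (f' has_real_derivative f'' x) (at x within {a..b})"
    "continuous_on {a..b} f''"
    using assms(1) unfolding C2_on_def by blast
  have sub: "{c..d} \<subseteq> {a..b}" using assms by auto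
  show ?thesis
    by (rule C2_onI[of c d f f' f'']; (rule DERIV_subset[OF _ sub] continuous_on_subset[OF _ sub])?)
       (use * sub in auto)
qed

lemma C2_on_cong:
  assumes "C2_on a b f" "\<And>x. x \<in> {a..b} \<Longrightarrow> g x = f x"
  shows "C2_on a b g"
proof -
  obtain f' f'' where *:
    "\<And>x. x \<in> {a..b} \<Longrightarrow> (f has_real_derivative f' x) (at x within {a..b})"
    "\<And>x. x \<in> {a..b} \<Longrightarrow> (f' has_real_derivative f'' x) (at x within {a..b})"
    "continuous_on {a..b} f''"
    using assms(1) unfolding C2_on_def by blast
  show ?thesis
    by (rule C2_onI[of a b g f' f''])
       (use * assms(2) in \<open>auto intro: has_field_derivative_transform_within[where f = f, OF _ zero_less_one]\<close>)
qed

lemma C2_on_mult: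
  assumes "C2_on a b f" "C2_on a b g"
  shows "C2_on a b (\<lambda>x. f x * g x)"
proof -
  obtain f' f'' where f:
    "\<And>x. x \<in> {a..b} \<Longrightarrow> (f has_real_derivative f' x) (at x within {a..b})"
    "\<And>x. x \<in> {a..b} \<Longrightarrow> (f' has_real_derivative f'' x) (at x within {a..b})"
    "continuous_on {a..b} f" "continuous_on {a..b} f'" "continuous_on {a..b} f''"
    using C2_onE[OF assms(1)] by metis
  obtain g' g'' where g:
    "\<And>x. x \<in> {a..b} \<Longrightarrow> (g has_real_derivative g' x) (at x within {a..b})"
    "\<And>x. x \<in> {a..b} \<Longrightarrow> (g' has_real_derivative g'' x) (at x within {a..b})"
    "continuous_on {a..b} g" "continuous_on {a..b} g'" "continuous_on {a..b} g''"
    using C2_onE[OF assms(2)] by metis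
  show ?thesis
  proof (rule C2_onI)
    show "((\<lambda>x. f x * g x) has_real_derivative f' x * g x + f x * g' x) (at x within {a..b})"
      if "x \<in> {a..b}" for x
      using f(1)[OF that] g(1)[OF that] by (auto intro!: derivative_eq_intros)
    show "((\<lambda>x. f' x * g x + f x * g' x) has_real_derivative
        f'' x * g x + 2 * (f' x * g' x) + f x * g'' x) (at x within {a..b})"
      if "x \<in> {a..b}" for x
      using f(1,2)[OF that] g(1,2)[OF that] by (auto intro!: derivative_eq_intros)
    show "continuous_on {a..b} (\<lambda>x. f'' x * g x + 2 * (f' x * g' x) + f x * g'' x)"
      by (intro continuous_intros f g)
  qed
qed

text \<open>The outer derivatives are required only at the values of \<open>f\<close>, so that
  \<open>F\<close> may be a real power, to be differentiated at positive arguments only.\<close>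

lemma C2_on_compose:
  assumes "C2_on a b f"
    and F: "\<And>x. x \<in> {a..b} \<Longrightarrow> (F has_real_derivative F' (f x)) (at (f x))"
      "\<And>x. x \<in> {a..b} \<Longrightarrow> (F' has_real_derivative F'' (f x)) (at (f x))"
      "continuous_on (f ` {a..b}) F''"
  shows "C2_on a b (\<lambda>x. F (f x))"
proof -
  obtain f' f'' where f:
    "\<And>x. x \<in> {a..b} \<Longrightarrow> (f has_real_derivative f' x) (at x within {a..b})"
    "\<And>x. x \<in> {a..b} \<Longrightarrow> (f' has_real_derivative f'' x) (at x within {a..b})"
    "continuous_on {a..b} f" "continuous_on {a..b} f'" "continuous_on {a..b} f''"
    using C2_onE[OF assms(1)] by metis
  have D: "((\<lambda>x. F (f x)) has_real_derivative F' (f x) * f' x) (at x within {a..b})"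
    "((\<lambda>x. F' (f x)) has_real_derivative F'' (f x) * f' x) (at x within {a..b})"
    if "x \<in> {a..b}" for x
    using DERIV_chain2[where f = F and g = f, OF F(1)[OF that] f(1)[OF that]]
      DERIV_chain2[where f = F' and g = f, OF F(2)[OF that] f(1)[OF that]] by blast+
  have cF': "continuous_on {a..b} (\<lambda>x. F' (f x))"
    by (rule DERIV_continuous_on) (rule D(2))
  have cF'': "continuous_on {a..b} (\<lambda>x. F'' (f x))"
    by (rule continuous_on_compose2[OF F(3) f(3)]) simp
  show ?thesis
  proof (rule C2_onI)
    show "((\<lambda>x. F (f x)) has_real_derivative F' (f x) * f' x) (at x within {a..b})"
      if "x \<in> {a..b}" for x using D(1)[OF that] .
    show "((\<lambda>x. F' (f x) * f' x) has_real_derivative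
        F'' (f x) * f' x * f' x + F' (f x) * f'' x) (at x within {a..b})"
      if "x \<in> {a..b}" for x
      using D(2)[OF that] f(2)[OF that] by (auto intro!: derivative_eq_intros)
    show "continuous_on {a..b} (\<lambda>x. F'' (f x) * f' x * f' x + F' (f x) * f'' x)"
      by (intro continuous_intros f cF' cF'')
  qed
qed

lemma C2_on_linear: "C2_on a b (\<lambda>x. c * x + d)"
  by (rule C2_onI[where f' = "\<lambda>_. c" and f'' = "\<lambda>_. 0"])
     (auto intro!: derivative_eq_intros)

lemma C2_on_powr:
  assumes "C2_on a b f" "\<And>x. x \<in> {a..b} \<Longrightarrow> f x > 0"
  shows "C2_on a b (\<lambda>x. f x powr c)"
proof (rule C2_on_compose[OF assms(1), where F' = "\<lambda>t. c * t powr (c - 1)"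
      and F'' = "\<lambda>t. c * ((c - 1) * t powr (c - 1 - 1))"])
  fix x assume "x \<in> {a..b}"
  then have pos: "f x > 0" by (rule assms(2))
  show "((\<lambda>t. t powr c) has_real_derivative c * f x powr (c - 1)) (at (f x))"
    using has_real_derivative_powr[OF pos] .
  show "((\<lambda>t. c * t powr (c - 1)) has_real_derivative c * ((c - 1) * f x powr (c - 1 - 1))) (at (f x))"
    by (intro DERIV_cmult has_real_derivative_powr pos)
next
  show "continuous_on (f ` {a..b}) (\<lambda>t. c * ((c - 1) * t powr (c - 1 - 1)))"
    using assms(2) by (intro continuous_intros) fastforce
qed

lemma C2_on_bounded:
  assumes "C2_on a b f"
  obtains C where "C \<ge> 0" "\<And>x. x \<in> {a..b} \<Longrightarrow> \<bar>f x\<bar> \<le> C"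
proof -
  have "bounded (f ` {a..b})"
    by (rule compact_imp_bounded, rule compact_continuous_image)
       (use C2_on_continuous_on[OF assms] in auto)
  then obtain C where "\<forall>x\<in>{a..b}. \<bar>f x\<bar> \<le> C"
    unfolding bounded_iff by auto
  then have "\<bar>f x\<bar> \<le> max C 0" if "x \<in> {a..b}" for x using that by fastforce
  then show thesis using that[of "max C 0"] by auto
qed

text \<open>One constant bounding both derivatives by compactness serves all three estimates. The
  remainder carries \<open>C\<close> instead of \<open>C / 2\<close> because it comes from the mean
  value inequality alone.\<close>

lemma C2_on_Taylor:
  assumes "C2_on a b f"
  obtains f' C where "C \<ge> 0"
    "\<And>x. x \<in> {a..b} \<Longrightarrow> \<bar>f' x\<bar> \<le> C"
    "\<And>x y. x \<in> {a..b} \<Longrightarrow> y \<in> {a..b} \<Longrightarrow> \<bar>f' y - f' x\<bar> \<le> C * \<bar>y - x\<bar>"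
    "\<And>x y. x \<in> {a..b} \<Longrightarrow> y \<in> {a..b} \<Longrightarrow> \<bar>f y - f x - f' x * (y - x)\<bar> \<le> C * (y - x)\<^sup>2"
proof -
  obtain f' f'' where f:
    "\<And>x. x \<in> {a..b} \<Longrightarrow> (f has_real_derivative f' x) (at x within {a..b})"
    "\<And>x. x \<in> {a..b} \<Longrightarrow> (f' has_real_derivative f'' x) (at x within {a..b})"
    "continuous_on {a..b} f" "continuous_on {a..b} f'" "continuous_on {a..b} f''"
    using C2_onE[OF assms(1)] by metis
  have "bounded (f' ` {a..b})" "bounded (f'' ` {a..b})"
    using f by (auto intro!: compact_imp_bounded compact_continuous_image)
  then obtain C1 C2 where C1: "\<And>x. x \<in> {a..b} \<Longrightarrow> \<bar>f' x\<bar> \<le> C1"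
    and C2: "\<And>x. x \<in> {a..b} \<Longrightarrow> \<bar>f'' x\<bar> \<le> C2"
    unfolding bounded_iff by fastforce
  define C where "C = max 0 (max C1 C2)"
  have C: "C \<ge> 0" "\<And>x. x \<in> {a..b} \<Longrightarrow> \<bar>f' x\<bar> \<le> C" "\<And>x. x \<in> {a..b} \<Longrightarrow> \<bar>f'' x\<bar> \<le> C"
    using C1 C2 unfolding C_def by fastforce+
  have L: "\<bar>f' y - f' x\<bar> \<le> C * \<bar>y - x\<bar>" if "x \<in> {a..b}" "y \<in> {a..b}" for x y
    using field_differentiable_bound[of "{a..b}" f' f'' C y x] f(2) C(3) that by auto
  have T: "\<bar>f y - f x - f' x * (y - x)\<bar> \<le> C * (y - x)\<^sup>2" if xy: "x \<in> {a..b}" "y \<in> {a..b}" for x y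
  proof -
    let ?S = "{min x y..max x y}"
    have sub: "?S \<subseteq> {a..b}" using xy by auto
    \<comment> \<open>Subtracting the slope at \<open>x\<close> leaves a function with derivative
      \<open>f' z - f' x\<close>, of size at most \<open>C * \<bar>y - x\<bar>\<close> on the
      segment from \<open>x\<close> to \<open>y\<close>.\<close>
    have "norm ((f y - f' x * y) - (f x - f' x * x)) \<le> (C * \<bar>y - x\<bar>) * norm (y - x)"
    proof (rule field_differentiable_bound[of ?S _ "\<lambda>z. f' z - f' x"])
      fix z assume z: "z \<in> ?S"
      have "(f has_real_derivative f' z) (at z within ?S)"
        using DERIV_subset[OF f(1) sub] z sub by blast
      then show "((\<lambda>z. f z - f' x * z) has_real_derivative f' z - f' x) (at z within ?S)"
        by (auto intro!: derivative_eq_intros)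
      have "\<bar>f' z - f' x\<bar> \<le> C * \<bar>z - x\<bar>" using L xy z sub by blast
      also have "\<dots> \<le> C * \<bar>y - x\<bar>" using z C(1) by (intro mult_left_mono) auto
      finally show "norm (f' z - f' x) \<le> C * \<bar>y - x\<bar>" by simp
    qed auto
    then show ?thesis by (simp add: algebra_simps power2_eq_square abs_mult_self_eq flip: abs_mult)
  qed
  show thesis using that[OF C(1,2) L T] by blast
qed

section \<open>The cardinal sine\<close>

text \<open>The removable singularity is filled, so that dividing a sine by its argument leaves a
  function that is smooth across the zero.\<close>

definition sinc :: "real \<Rightarrow> real" where
  "sinc x = (if x = 0 then 1 else sin x / x)"

lemma sinc_times: "sinc x * x = sin x"
  by (simp add: sinc_def)

lemma sinc_pos:
  assumes "\<bar>x\<bar> < pi"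
  shows "sinc x > 0"
proof (cases "x > 0")
  case True
  then show ?thesis using assms sin_gt_zero[of x] by (simp add: sinc_def)
next
  case False
  then show ?thesis using assms sin_gt_zero[of "-x"] by (auto simp: sinc_def divide_simps)
qed

text \<open>The sine series has no constant term, so dividing it by \<open>x\<close> shifts the
  coefficients by one.\<close>

lemma sinc_sums: "(\<lambda>n. sin_coeff (Suc n) * x ^ n) sums sinc x"
proof (cases "x = 0")
  case True
  have "(\<lambda>n. sin_coeff (Suc n) * 0 ^ n) sums (sin_coeff (Suc 0) :: real)"
    using powser_sums_zero[of "\<lambda>n. sin_coeff (Suc n) :: real"] by simp
  with True show ?thesis by (simp add: sinc_def sin_coeff_def)
next
  case False
  have "(\<lambda>n. sin_coeff n * x ^ n) sums sin x" using sin_converges[of x] by simp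
  then have "(\<lambda>n. sin_coeff (Suc n) * x ^ Suc n) sums sin x"
    using sums_Suc_iff[of "\<lambda>n. sin_coeff n * x ^ n"] by (simp add: sin_coeff_def)
  then have "(\<lambda>n. sin_coeff (Suc n) * x ^ Suc n / x) sums (sin x / x)" by (rule sums_divide)
  with False show ?thesis by (simp add: sinc_def field_simps)
qed

text \<open>As the sum of an everywhere convergent power series, \<open>sinc\<close> can be
  differentiated termwise, without a separate treatment of 0.\<close>

lemma C2_on_sinc:
  assumes "C2_on a b g"
  shows "C2_on a b (\<lambda>x. sinc (g x))"
proof -
  define c :: "nat \<Rightarrow> real" where "c n = sin_coeff (Suc n)" for n
  define P where "P d x = (\<Sum>n. d n * x ^ n)" for d :: "nat \<Rightarrow> real" and x
  have sc: "summable (\<lambda>n. c n * x ^ n)" for x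
    using sinc_sums unfolding c_def by (rule sums_summable)
  have sd: "summable (\<lambda>n. diffs d n * x ^ n)" if "\<And>x. summable (\<lambda>n. d n * x ^ n)"
    for d :: "nat \<Rightarrow> real" and x
    by (rule termdiff_converges_all) (rule that)
  have D: "(P d has_real_derivative P (diffs d) x) (at x)" if "\<And>x. summable (\<lambda>n. d n * x ^ n)"
    for d x unfolding P_def
    by (rule termdiffs_strong_converges_everywhere) (rule that)
  have "sinc = P c" unfolding P_def c_def using sums_unique[OF sinc_sums] by auto
  \<comment> \<open>\<open>diffs\<close> gives the coefficients of the derived series; the third one
    enters only to make the second derivative continuous.\<close>
  moreover have "C2_on a b (\<lambda>x. P c (g x))"
    by (rule C2_on_compose[OF assms, where F' = "P (diffs c)" and F'' = "P (diffs (diffs c))"])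
       (intro D sd sc DERIV_continuous_on[where D = "P (diffs (diffs (diffs c)))"]
          has_field_derivative_at_within)+
  ultimately show ?thesis by simp
qed

section \<open>Integrals of powers of a distance\<close>

lemma has_integral_dist_powr:
  fixes c p a b :: real
  assumes "p > -1" "a \<le> b" "b \<le> c \<or> c \<le> a"
  shows "((\<lambda>x. \<bar>x - c\<bar> powr p) has_integral
    (sgn (b - c) * \<bar>b - c\<bar> powr (p + 1) - sgn (a - c) * \<bar>a - c\<bar> powr (p + 1)) / (p + 1)) {a..b}"
proof -
  have "((\<lambda>x. \<bar>x - c\<bar> powr p) has_integral
     sgn (b - c) * \<bar>b - c\<bar> powr (p + 1) / (p + 1) - sgn (a - c) * \<bar>a - c\<bar> powr (p + 1) / (p + 1)) {a..b}"
  proof (rule fundamental_theorem_of_calculus_interior[OF assms(2)])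
    have "continuous_on {a..b} (\<lambda>x. sgn (x - c) * \<bar>x - c\<bar> powr (p + 1))"
    proof (cases "c \<le> a")
      case True
      have "continuous_on {a..b} (\<lambda>x. (x - c) powr (p + 1))"
        using True assms by (intro continuous_on_powr' continuous_intros) auto
      then show ?thesis
        by (rule continuous_on_eq) (use True in \<open>auto simp: sgn_if\<close>)
    next
      case False
      have "continuous_on {a..b} (\<lambda>x. - ((c - x) powr (p + 1)))"
        using False assms by (intro continuous_on_minus continuous_on_powr' continuous_intros) auto
      then show ?thesis
        by (rule continuous_on_eq) (use False assms in \<open>auto simp: sgn_if\<close>)
    qed
    then show "continuous_on {a..b} (\<lambda>x. sgn (x - c) * \<bar>x - c\<bar> powr (p + 1) / (p + 1))"
      by (rule continuous_on_divide) (use assms(1) in auto)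
    fix x assume x: "x \<in> {a<..<b}"
    have "((\<lambda>x. sgn (x - c) * \<bar>x - c\<bar> powr (p + 1) / (p + 1)) has_real_derivative \<bar>x - c\<bar> powr p) (at x)"
    proof (cases "c \<le> a")
      case True
      have "((\<lambda>x. (x - c) powr (p + 1) / (p + 1)) has_real_derivative \<bar>x - c\<bar> powr p) (at x)"
        using x True assms(1) by (auto intro!: derivative_eq_intros)
      then show ?thesis
        by (rule has_field_derivative_transform_within_open[where S = "{a<..<b}"])
           (use x True in \<open>auto simp: sgn_if\<close>)
    next
      case False
      have "((\<lambda>x. - ((c - x) powr (p + 1) / (p + 1))) has_real_derivative \<bar>x - c\<bar> powr p) (at x)"
        using x False assms by (auto intro!: derivative_eq_intros simp: abs_if)
      then show ?thesis
        by (rule has_field_derivative_transform_within_open[where S = "{a<..<b}"])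
           (use x False assms in \<open>auto simp: sgn_if\<close>)
    qed
    then show "((\<lambda>x. sgn (x - c) * \<bar>x - c\<bar> powr (p + 1) / (p + 1)) has_vector_derivative \<bar>x - c\<bar> powr p) (at x)"
      by (simp add: has_real_derivative_iff_has_vector_derivative)
  qed
  then show ?thesis by (simp add: diff_divide_distrib)
qed

text \<open>Every point between \<open>y\<close> and \<open>z\<close> is within a factor two of
  both, so the mean value inequality applies with a derivative comparable to
  \<open>y powr p / z\<close>. The bound is stated in terms of \<open>y\<close> so that, for
  variable \<open>y\<close>, it is a multiple of the weight itself.\<close>

lemma powr_diff_le:
  fixes y z p :: real
  assumes "y > 0" "z > 0" "y \<le> 2 * z" "z \<le> 2 * y"
  shows "z * \<bar>y powr p - z powr p\<bar> \<le> 2 * \<bar>p\<bar> * 2 powr \<bar>p\<bar> * \<bar>y - z\<bar> * y powr p"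
proof -
  define B where "B = \<bar>p\<bar> * (2 powr \<bar>p\<bar> * y powr p * (2 / z))"
  let ?S = "{min y z..max y z}"
  have "norm (y powr p - z powr p) \<le> B * norm (y - z)"
  proof (rule field_differentiable_bound[of ?S _ "\<lambda>t. p * t powr (p - 1)"])
    fix t assume t: "t \<in> ?S"
    have "y \<le> t \<or> z \<le> t" "t \<le> y \<or> t \<le> z"
      using t by (simp_all add: min_le_iff_disj le_max_iff_disj)
    then have t0: "t > 0" and tz: "z \<le> 2 * t" and ty: "t \<le> 2 * y" "y \<le> 2 * t"
      using assms by argo+
    show "((\<lambda>t. t powr p) has_real_derivative p * t powr (p - 1)) (at t within ?S)"
      by (rule has_field_derivative_at_within[OF has_real_derivative_powr[OF t0]])
    \<comment> \<open>Logarithms turn the factor two into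
      \<open>\<bar>ln t - ln y\<bar> \<le> ln 2\<close>, which treats both signs of \<open>p\<close>
      at once.\<close>
    have "ln t \<le> ln (2 * y)" "ln y \<le> ln (2 * t)"
      using t0 ty assms(1) by simp_all
    then have "\<bar>ln t - ln y\<bar> \<le> ln 2"
      using t0 assms(1) by (simp add: ln_mult abs_le_iff)
    then have "\<bar>p\<bar> * \<bar>ln t - ln y\<bar> \<le> \<bar>p\<bar> * ln 2" by (rule mult_left_mono) simp
    then have "p * (ln t - ln y) \<le> \<bar>p\<bar> * ln 2"
      using abs_ge_self[of "p * (ln t - ln y)"] unfolding abs_mult by linarith
    then have "exp (p * ln t) \<le> exp (\<bar>p\<bar> * ln 2 + p * ln y)"
      by (simp add: algebra_simps)
    then have "t powr p \<le> 2 powr \<bar>p\<bar> * y powr p"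
      using t0 assms by (simp add: powr_def exp_add)
    moreover have "1 / t \<le> 2 / z" using t0 tz assms by (simp add: field_simps)
    ultimately have "t powr p * (1 / t) \<le> 2 powr \<bar>p\<bar> * y powr p * (2 / z)"
      using t0 by (intro mult_mono) auto
    moreover have "t powr (p - 1) = t powr p * (1 / t)"
      using t0 by (simp add: powr_diff)
    ultimately show "norm (p * t powr (p - 1)) \<le> B"
      unfolding B_def real_norm_def abs_mult using t0 by (intro mult_left_mono) auto
  qed auto
  then have "z * \<bar>y powr p - z powr p\<bar> \<le> z * (B * \<bar>y - z\<bar>)"
    using assms by simp
  also have "\<dots> = 2 * \<bar>p\<bar> * 2 powr \<bar>p\<bar> * \<bar>y - z\<bar> * y powr p"
    using assms by (simp add: B_def field_simps)
  finally show ?thesis .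
qed

section \<open>Product integration on one cell\<close>

text \<open>The weight may be unbounded. Nonnegativity makes it absolutely integrable, and a bounded
  measurable factor preserves that.\<close>

lemma integrable_continuous_mult:
  fixes g w :: "real \<Rightarrow> real"
  assumes "continuous_on {a..b} g" "w integrable_on {a..b}" "\<And>x. x \<in> {a..b} \<Longrightarrow> w x \<ge> 0"
  shows "(\<lambda>x. g x * w x) integrable_on {a..b}"
proof -
  have "w absolutely_integrable_on {a..b}"
    using assms(2,3) by (rule nonnegative_absolutely_integrable_1)
  moreover have "g \<in> borel_measurable (lebesgue_on {a..b})"
    using assms(1) by (intro continuous_imp_measurable_on_sets_lebesgue) auto
  moreover have "bounded (g ` {a..b})"
    using assms(1) by (intro compact_imp_bounded compact_continuous_image) auto
  ultimately have "(\<lambda>x. g x * w x) absolutely_integrable_on {a..b}"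
    by (intro absolutely_integrable_bounded_measurable_product_real) auto
  then show ?thesis by (rule set_lebesgue_integral_eq_integral(1))
qed

lemma integral_diff_midpoint:
  fixes a b :: real
  assumes "a \<le> b"
  shows "((\<lambda>x. x - (a + b) / 2) has_integral 0) {a..b}"
proof -
  have "((\<lambda>x. x - (a + b) / 2) has_integral
      (b\<^sup>2 / 2 - (a + b) / 2 * b) - (a\<^sup>2 / 2 - (a + b) / 2 * a)) {a..b}"
    by (rule fundamental_theorem_of_calculus[OF assms])
       (auto simp flip: has_real_derivative_iff_has_vector_derivative intro!: derivative_eq_intros)
  moreover have "(b\<^sup>2 / 2 - (a + b) / 2 * b) - (a\<^sup>2 / 2 - (a + b) / 2 * a) = 0"
    by (simp add: field_simps power2_eq_square)
  ultimately show ?thesis by simp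
qed

text \<open>Since \<open>x - (a + b) / 2\<close> has integral zero, any constant \<open>c\<close>
  may be subtracted from the weight for free; only the deviation of the weight from \<open>c\<close>
  counts.\<close>

lemma first_moment_bound:
  fixes w e :: "real \<Rightarrow> real"
  assumes "a \<le> b" "w integrable_on {a..b}" "\<And>x. x \<in> {a..b} \<Longrightarrow> w x \<ge> 0"
    and "e integrable_on {a..b}"
    and "\<And>x. x \<in> {a..b} \<Longrightarrow> \<bar>(x - (a + b) / 2) * (w x - c)\<bar> \<le> e x"
  shows "\<bar>integral {a..b} (\<lambda>x. (x - (a + b) / 2) * w x)\<bar> \<le> integral {a..b} e"
proof -
  let ?m = "(a + b) / 2"
  have i1: "(\<lambda>x. (x - ?m) * w x) integrable_on {a..b}"
    using assms(2,3) by (intro integrable_continuous_mult continuous_intros) auto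
  have i2: "((\<lambda>x. (x - ?m) * c) has_integral 0 * c) {a..b}"
    by (rule has_integral_mult_left[OF integral_diff_midpoint[OF assms(1)]])
  have "((\<lambda>x. (x - ?m) * w x - (x - ?m) * c) has_integral
      integral {a..b} (\<lambda>x. (x - ?m) * w x) - 0 * c) {a..b}"
    by (rule has_integral_diff[OF integrable_integral[OF i1] i2])
  then have I: "((\<lambda>x. (x - ?m) * (w x - c)) has_integral
      integral {a..b} (\<lambda>x. (x - ?m) * w x)) {a..b}"
    by (simp only: right_diff_distrib mult_zero_left diff_zero)
  then have "norm (integral {a..b} (\<lambda>x. (x - ?m) * (w x - c))) \<le> integral {a..b} e"
    using assms(4,5) by (intro integral_norm_bound_integral) auto
  then show ?thesis using I by (simp add: integral_unique)
qed

text \<open>The linear term of the expansion about the midpoint integrates to zero, so only the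
  second-order remainder contributes.\<close>

lemma midpoint_rule_error:
  fixes q :: "real \<Rightarrow> real"
  assumes "a \<le> b" "q integrable_on {a..b}"
    and "\<And>x. x \<in> {a..b} \<Longrightarrow> \<bar>q x - q ((a + b) / 2) - d * (x - (a + b) / 2)\<bar> \<le> B"
  shows "\<bar>integral {a..b} q - (b - a) * q ((a + b) / 2)\<bar> \<le> (b - a) * B"
proof -
  let ?m = "(a + b) / 2"
  have "((\<lambda>x. q x - q ?m - d * (x - ?m)) has_integral
      integral {a..b} q - (b - a) * q ?m - d * 0) {a..b}"
    using assms(1,2) has_integral_const_real[of "q ?m" a b]
    by (intro has_integral_diff has_integral_mult_right integral_diff_midpoint integrable_integral) auto
  moreover have "((\<lambda>x. B) has_integral (b - a) * B) {a..b}"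
    using has_integral_const_real[of B a b] assms(1) by auto
  ultimately show ?thesis
    using integral_norm_bound_integral[of "\<lambda>x. q x - q ?m - d * (x - ?m)" "{a..b}" "\<lambda>_. B"] assms(3)
    by (auto simp: has_integral_iff)
qed

text \<open>Two errors are made: \<open>P\<close> is frozen at the midpoint under the exactly
  integrated weight \<open>w\<close>, and the midpoint value of \<open>q\<close> is replaced by its
  mean over the cell. The first-order term with \<open>p\<close> stays on the left, because near
  \<open>s\<close> it is small only after mirror cells are paired. The two power weights take turns
  in the roles of \<open>w\<close> and \<open>q\<close>.\<close>

lemma product_rule_error:
  fixes w P q :: "real \<Rightarrow> real"
  assumes ab: "a < b"
    and w: "w integrable_on {a..b}" "\<And>x. x \<in> {a..b} \<Longrightarrow> w x \<ge> 0"
    and P: "continuous_on {a..b} P"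
      "\<And>x. x \<in> {a..b} \<Longrightarrow> \<bar>P x - P ((a + b) / 2) - p * (x - (a + b) / 2)\<bar> \<le> A"
    and q: "q integrable_on {a..b}"
      "\<And>x. x \<in> {a..b} \<Longrightarrow> \<bar>q x - q ((a + b) / 2) - d * (x - (a + b) / 2)\<bar> \<le> B"
    and g: "P ((a + b) / 2) = q ((a + b) / 2) * g" "\<bar>g\<bar> \<le> C"
  shows "\<bar>integral {a..b} (\<lambda>x. P x * w x) - 1 / (b - a) * g * integral {a..b} w * integral {a..b} q
      - p * integral {a..b} (\<lambda>x. (x - (a + b) / 2) * w x)\<bar> \<le> (A + C * B) * integral {a..b} w"
proof -
  let ?m = "(a + b) / 2"
  define W where "W = integral {a..b} w"
  define J where "J = integral {a..b} (\<lambda>x. (x - ?m) * w x)"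
  define I where "I = integral {a..b} (\<lambda>x. P x * w x)"
  define Q where "Q = integral {a..b} q"
  have W0: "W \<ge> 0" unfolding W_def using w by (intro integral_nonneg) auto
  have hW: "(w has_integral W) {a..b}"
    unfolding W_def using w(1) by (rule integrable_integral)
  have hJ: "((\<lambda>x. (x - ?m) * w x) has_integral J) {a..b}"
    unfolding J_def using w by (intro integrable_integral integrable_continuous_mult continuous_intros) auto
  have hI: "((\<lambda>x. P x * w x) has_integral I) {a..b}"
    unfolding I_def using w P(1) by (intro integrable_integral integrable_continuous_mult) auto
  have "((\<lambda>x. P x * w x - P ?m * w x - p * ((x - ?m) * w x)) has_integral I - P ?m * W - p * J) {a..b}"
    by (intro has_integral_diff has_integral_mult_right hW hJ hI)
  moreover have "((\<lambda>x. A * w x) has_integral A * W) {a..b}"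
    by (intro has_integral_mult_right hW)
  moreover have "\<bar>P x * w x - P ?m * w x - p * ((x - ?m) * w x)\<bar> \<le> A * w x" if "x \<in> {a..b}" for x
  proof -
    have "P x * w x - P ?m * w x - p * ((x - ?m) * w x) = (P x - P ?m - p * (x - ?m)) * w x"
      by (simp add: algebra_simps)
    then show ?thesis
      using P(2)[OF that] w(2)[OF that] by (simp add: abs_mult mult_right_mono)
  qed
  ultimately have 1: "\<bar>I - P ?m * W - p * J\<bar> \<le> A * W"
    using integral_norm_bound_integral[of "\<lambda>x. P x * w x - P ?m * w x - p * ((x - ?m) * w x)" "{a..b}" "\<lambda>x. A * w x"]
    by (auto simp: has_integral_iff)
  have "\<bar>Q - (b - a) * q ?m\<bar> \<le> (b - a) * B"
    unfolding Q_def using midpoint_rule_error[OF less_imp_le[OF ab] q] .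
  then have "\<bar>Q / (b - a) - q ?m\<bar> \<le> B"
    using ab by (simp add: abs_le_iff field_simps)
  then have "\<bar>(g * W) * (Q / (b - a) - q ?m)\<bar> \<le> C * W * B"
    unfolding abs_mult using g(2) W0 by (intro mult_mono) auto
  moreover have "(g * W) * (Q / (b - a) - q ?m) = 1 / (b - a) * g * W * Q - P ?m * W"
    using g(1) by (simp add: algebra_simps)
  ultimately have 2: "\<bar>1 / (b - a) * g * W * Q - P ?m * W\<bar> \<le> C * W * B" by simp
  have "\<bar>I - 1 / (b - a) * g * W * Q - p * J\<bar> \<le> A * W + C * W * B"
    using 1 2 by linarith
  then show ?thesis unfolding W_def J_def I_def Q_def by (simp add: algebra_simps)
qed

text \<open>Relative to the integral of the weight, the moment decays like the inverse distance of
  the cell from \<open>s\<close>. By \<open>grid\<close> a cell without an end at \<open>s\<close>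
  is at least its own width away, so the distances of its points from \<open>s\<close> agree with
  that of the midpoint up to a factor two.\<close>

lemma first_moment_dist_powr_bound:
  fixes a b s p :: real
  assumes "a < b" "p > -1" "b \<le> s \<or> s \<le> a"
    and grid: "a = s \<or> b = s \<or> b - a \<le> \<bar>a - s\<bar> \<and> b - a \<le> \<bar>b - s\<bar>"
  shows "\<bar>(a + b) / 2 - s\<bar> * \<bar>integral {a..b} (\<lambda>x. (x - (a + b) / 2) * \<bar>x - s\<bar> powr p)\<bar>
    \<le> (1 + 2 * \<bar>p\<bar> * 2 powr \<bar>p\<bar>) * (b - a)\<^sup>2 * integral {a..b} (\<lambda>x. \<bar>x - s\<bar> powr p)"
proof -
  let ?m = "(a + b) / 2" and ?v = "\<lambda>x. \<bar>x - s\<bar> powr p"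
  let ?K = "2 * \<bar>p\<bar> * 2 powr \<bar>p\<bar>"
  \<comment> \<open>On a cell with an end at \<open>s\<close> the weight is not comparable with its
    midpoint value; subtracting nothing suffices there, because the midpoint is within
    \<open>b - a\<close> of \<open>s\<close>.\<close>
  define c where "c = (if a = s \<or> b = s then 0 else ?v ?m)"
  have v: "?v integrable_on {a..b}"
    using has_integral_dist_powr[of p a b s] assms by auto
  have "\<bar>(x - ?m) * (?v x - c)\<bar> \<le> (1 + ?K) * (b - a)\<^sup>2 / \<bar>?m - s\<bar> * ?v x" if x: "x \<in> {a..b}" for x
  proof -
    have ms: "\<bar>?m - s\<bar> > 0" using assms by auto
    have xm: "\<bar>x - ?m\<bar> \<le> b - a" using x by (auto simp: abs_le_iff field_simps)
    have main: "\<bar>?m - s\<bar> * \<bar>?v x - c\<bar> \<le> (1 + ?K) * (b - a) * ?v x"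
    proof (cases "a = s \<or> b = s")
      case True
      then have "c = 0" "\<bar>?m - s\<bar> \<le> b - a"
        using assms(1) by (auto simp: c_def abs_le_iff field_simps)
      moreover have "b - a \<le> (1 + ?K) * (b - a)"
        using assms(1) mult_right_mono[of 1 "1 + ?K" "b - a"] by simp
      ultimately show ?thesis by (auto intro!: mult_right_mono)
    next
      case False
      have "\<bar>?m - s\<bar> * \<bar>?v x - ?v ?m\<bar> \<le> ?K * \<bar>\<bar>x - s\<bar> - \<bar>?m - s\<bar>\<bar> * ?v x"
        using False grid assms(1,3) x by (intro powr_diff_le) (auto simp: abs_if field_simps)
      also have "\<dots> \<le> ?K * (b - a) * ?v x"
        using xm by (intro mult_right_mono mult_left_mono) auto
      also have "\<dots> \<le> (1 + ?K) * (b - a) * ?v x"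
        using assms(1) by (intro mult_right_mono) auto
      finally show ?thesis using False by (simp add: c_def)
    qed
    have "\<bar>?m - s\<bar> * \<bar>(x - ?m) * (?v x - c)\<bar> = \<bar>x - ?m\<bar> * (\<bar>?m - s\<bar> * \<bar>?v x - c\<bar>)"
      by (simp add: abs_mult)
    also have "\<dots> \<le> (b - a) * ((1 + ?K) * (b - a) * ?v x)"
      by (rule mult_mono[OF xm main]) (use assms(1) in auto)
    finally show ?thesis using ms by (simp add: field_simps power2_eq_square)
  qed
  then have "\<bar>integral {a..b} (\<lambda>x. (x - ?m) * ?v x)\<bar>
      \<le> integral {a..b} (\<lambda>x. (1 + ?K) * (b - a)\<^sup>2 / \<bar>?m - s\<bar> * ?v x)"
    using assms(1) v by (intro first_moment_bound[where c = c] integrable_on_mult_right) auto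
  also have "\<dots> = (1 + ?K) * (b - a)\<^sup>2 / \<bar>?m - s\<bar> * integral {a..b} ?v"
    by (rule integral_mult_right)
  finally have "\<bar>?m - s\<bar> * \<bar>integral {a..b} (\<lambda>x. (x - ?m) * ?v x)\<bar>
      \<le> \<bar>?m - s\<bar> * ((1 + ?K) * (b - a)\<^sup>2 / \<bar>?m - s\<bar> * integral {a..b} ?v)"
    by (rule mult_left_mono) simp
  also have "\<dots> = (1 + ?K) * (b - a)\<^sup>2 * integral {a..b} ?v"
    using assms by auto
  finally show ?thesis .
qed

text \<open>Replacing \<open>x\<close> by \<open>2 * s - x\<close> keeps the weight and reverses the
  sign of the offset from the midpoint.\<close>

lemma first_moment_dist_powr_reflect:
  fixes a b s p :: real
  shows "integral {2 * s - b..2 * s - a} (\<lambda>x. (x - (2 * s - b + (2 * s - a)) / 2) * \<bar>x - s\<bar> powr p)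
    = - integral {a..b} (\<lambda>x. (x - (a + b) / 2) * \<bar>x - s\<bar> powr p)"
proof -
  let ?f = "\<lambda>x. (x - (2 * s - b + (2 * s - a)) / 2) * \<bar>x - s\<bar> powr p"
  have "integral {2 * s - b..2 * s - a} ?f = integral {- b..- a} (\<lambda>x. ?f (2 * s + x))"
    using integral_shift_Icc_real[of "- b" "- a" ?f "2 * s"] by (simp add: o_def add.commute)
  also have "\<dots> = integral {a..b} (\<lambda>x. ?f (2 * s + - x))"
    using Henstock_Kurzweil_Integration.integral_reflect_real[of b a "\<lambda>x. ?f (2 * s + - x)"] by simp
  also have "\<dots> = integral {a..b} (\<lambda>x. - ((x - (a + b) / 2) * \<bar>x - s\<bar> powr p))"
    by (intro integral_cong) (simp add: field_simps abs_minus_commute)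
  also have "\<dots> = - integral {a..b} (\<lambda>x. (x - (a + b) / 2) * \<bar>x - s\<bar> powr p)"
    by (rule integral_neg)
  finally show ?thesis .
qed

lemma sum_integral_cells:
  fixes g :: "real \<Rightarrow> real"
  assumes "g integrable_on {0..h * real k}" "h \<ge> 0"
  shows "(\<Sum>n<k. integral {h * real n..h * (real n + 1)} g) = integral {0..h * real k} g"
  using assms(1)
proof (induction k)
  case 0
  then show ?case by simp
next
  case (Suc k)
  have le: "h * real k \<le> h * real (Suc k)" using assms(2) by (intro mult_left_mono) auto
  have "g integrable_on {0..h * real k}"
    by (rule integrable_subinterval_real[OF Suc.prems]) (use le in auto)
  then show ?case
    using Suc Henstock_Kurzweil_Integration.integral_combine[OF _ le Suc.prems] assms(2)
    by (simp add: add.commute)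
qed

section \<open>The quadrature error\<close>

locale singular_product =
  fixes \<beta> \<gamma> s :: real and f :: "real \<Rightarrow> real"
  assumes beta: "\<beta> > 0" and gamma: "\<gamma> > -1" and f: "C2_on 0 pi f"
    and s: "0 < s" "s < pi"
begin

definition edge :: "real \<Rightarrow> real" where "edge x = min x (pi - x)"
definition U :: "real \<Rightarrow> real" where "U x = edge x powr \<beta>"
definition V :: "real \<Rightarrow> real" where "V x = \<bar>x - s\<bar> powr \<gamma>"
text \<open>What remains of the integrand when the weights \<open>U\<close> and \<open>V\<close> are
  divided out; the rule samples this factor at the midpoint.\<close>

definition G :: "real \<Rightarrow> real" where "G x = sinc (edge x) powr \<beta> * sinc (x - s) powr \<gamma> * f x"
text \<open>The product of \<open>U\<close> and \<open>G\<close> on \<open>[0, pi]\<close>, written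
  with \<open>sin\<close> because this form shows the smoothness at \<open>pi / 2\<close> that is
  hidden by the kink of \<open>edge\<close>.\<close>

definition F :: "real \<Rightarrow> real" where "F x = sin x powr \<beta> * sinc (x - s) powr \<gamma> * f x"

text \<open>For a grid cell the subtracted term is a summand of \<open>quad_left\<close> or
  \<open>quad_right\<close>, including the factor \<open>1 / h\<close>, with the integrals of the
  weights left unevaluated.\<close>

definition cell_error :: "real \<Rightarrow> real \<Rightarrow> real" where
  "cell_error a b = integral {a..b} (\<lambda>x. F x * V x)
     - 1 / (b - a) * G ((a + b) / 2) * integral {a..b} U * integral {a..b} V"

definition moment :: "real \<Rightarrow> real \<Rightarrow> real" where
  "moment a b = integral {a..b} (\<lambda>x. (x - (a + b) / 2) * V x)"

definition one_sided :: "real \<Rightarrow> real \<Rightarrow> bool" where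
  "one_sided c d \<longleftrightarrow> 0 \<le> c \<and> d \<le> pi / 2 \<or> pi / 2 \<le> c \<and> d \<le> pi"

section \<open>Pointwise identities and integrals of the two weights\<close>

lemma one_sided_bounds: "one_sided c d \<Longrightarrow> x \<in> {c..d} \<Longrightarrow> 0 \<le> x \<and> x \<le> pi"
  unfolding one_sided_def using pi_gt_zero by auto

text \<open>The redundant \<open>1 * x + 0\<close> fits the pattern \<open>c * x + d\<close> for
  which smoothness is known.\<close>

lemma edge_cases:
  assumes "one_sided c d"
  shows "(\<forall>x\<in>{c..d}. edge x = 1 * x + 0) \<or> (\<forall>x\<in>{c..d}. edge x = -1 * x + pi)"
  using assms by (auto simp: one_sided_def edge_def)

lemma edge_bounds:
  assumes "0 \<le> x" "x \<le> pi"
  shows "0 \<le> edge x" "edge x \<le> pi" "edge x < pi" "sinc (edge x) * edge x = sin x"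
proof -
  show "0 \<le> edge x" "edge x \<le> pi" "edge x < pi"
    using assms pi_gt_zero unfolding edge_def by linarith+
  show "sinc (edge x) * edge x = sin x"
    using sinc_times[of x] sinc_times[of "pi - x"] by (simp add: edge_def min_def)
qed

lemma sinc_edge_pos: "0 \<le> x \<Longrightarrow> x \<le> pi \<Longrightarrow> sinc (edge x) > 0"
  using edge_bounds[of x] by (intro sinc_pos) auto

lemma sinc_shift_pos: "0 \<le> x \<Longrightarrow> x \<le> pi \<Longrightarrow> sinc (x - s) > 0"
  using s by (intro sinc_pos) auto

text \<open>\<open>sinc (edge x) * edge x\<close> equals \<open>sin x\<close> on both halves because
  \<open>sin (pi - x) = sin x\<close>, and the power splits over this product.\<close>

lemma F_eq: "0 \<le> x \<Longrightarrow> x \<le> pi \<Longrightarrow> F x = U x * G x"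
  using sinc_edge_pos[of x] edge_bounds[of x]
  by (simp add: F_def U_def G_def mult.commute flip: edge_bounds(4) powr_mult)

lemma FV_eq:
  assumes "0 \<le> x" "x \<le> pi"
  shows "F x * V x = sin x powr \<beta> * \<bar>sin (x - s)\<bar> powr \<gamma> * f x"
  using sinc_shift_pos[OF assms]
  by (simp add: F_def V_def powr_mult abs_mult flip: sinc_times)

lemma V_nonneg: "V x \<ge> 0" and U_nonneg: "U x \<ge> 0"
  by (simp_all add: V_def U_def)

lemma V_has_integral:
  assumes "a \<le> b" "b \<le> s \<or> s \<le> a"
  shows "(V has_integral (sgn (b - s) * \<bar>b - s\<bar> powr (\<gamma> + 1)
      - sgn (a - s) * \<bar>a - s\<bar> powr (\<gamma> + 1)) / (\<gamma> + 1)) {a..b}"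
  unfolding V_def[abs_def] using has_integral_dist_powr[OF gamma assms] .

lemma V_integrable:
  assumes "0 \<le> a" "b \<le> pi"
  shows "V integrable_on {a..b}"
proof -
  have "V integrable_on {0..s}" "V integrable_on {s..pi}"
    using V_has_integral[of 0 s] V_has_integral[of s pi] s by auto
  then have "V integrable_on {0..pi}"
    using s by (auto intro: Henstock_Kurzweil_Integration.integrable_combine[of 0 s pi])
  then show ?thesis
    by (rule integrable_subinterval_real) (use assms in auto)
qed

lemma U_has_integral_left:
  assumes "0 \<le> a" "a \<le> b" "b \<le> pi / 2"
  shows "(U has_integral (b powr (\<beta> + 1) - a powr (\<beta> + 1)) / (\<beta> + 1)) {a..b}"
proof -
  have "((\<lambda>x. \<bar>x - 0\<bar> powr \<beta>) has_integral (b powr (\<beta> + 1) - a powr (\<beta> + 1)) / (\<beta> + 1)) {a..b}"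
    using has_integral_dist_powr[of \<beta> a b 0] assms beta by (auto simp: sgn_if split: if_splits)
  then show ?thesis
    by (rule has_integral_eq[rotated]) (use assms in \<open>auto simp: U_def edge_def min_def\<close>)
qed

lemma U_has_integral_right:
  assumes "pi / 2 \<le> a" "a \<le> b" "b \<le> pi"
  shows "(U has_integral ((pi - a) powr (\<beta> + 1) - (pi - b) powr (\<beta> + 1)) / (\<beta> + 1)) {a..b}"
proof -
  have edge: "edge x = pi - x" if "x \<in> {a..b}" for x
    using that assms unfolding edge_def by auto
  have "((\<lambda>x. \<bar>x - pi\<bar> powr \<beta>) has_integral
      ((pi - a) powr (\<beta> + 1) - (pi - b) powr (\<beta> + 1)) / (\<beta> + 1)) {a..b}"
    using has_integral_dist_powr[of \<beta> a b pi] assms beta by (auto simp: sgn_if abs_if split: if_splits)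
  then show ?thesis
    by (rule has_integral_eq[rotated]) (use assms edge in \<open>auto simp: U_def\<close>)
qed

lemma U_continuous: "continuous_on {0..pi} U"
  unfolding U_def[abs_def] edge_def[abs_def]
  using beta by (intro continuous_on_powr' continuous_intros) auto

lemma U_integrable: "0 \<le> a \<Longrightarrow> b \<le> pi \<Longrightarrow> U integrable_on {a..b}"
  by (rule integrable_continuous_real, rule continuous_on_subset[OF U_continuous]) auto

lemma U_le: "0 \<le> x \<Longrightarrow> x \<le> pi \<Longrightarrow> U x \<le> pi powr \<beta>"
  unfolding U_def using beta edge_bounds[of x] by (intro powr_mono2) auto

text \<open>\<open>U\<close> is monotone on either half, so its oscillation on a cell is its
  increment there; summed over the cells, these increments give the total variation.\<close>

lemma U_between:
  assumes "one_sided a b" "x \<in> {a..b}" "y \<in> {a..b}"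
  shows "\<bar>U x - U y\<bar> \<le> \<bar>U b - U a\<bar>"
proof -
  have mono: "U x \<le> U y" if "0 \<le> edge x" "edge x \<le> edge y" for x y
    unfolding U_def using that beta by (intro powr_mono2) auto
  have ab: "a \<le> b" "a \<in> {a..b}" "b \<in> {a..b}" using assms(2) by auto
  note bd = one_sided_bounds[OF assms(1)]
  have e: "0 \<le> edge z" if "z \<in> {a..b}" for z
    using edge_bounds(1) bd[OF that] by auto
  from edge_cases[OF assms(1)] show ?thesis
  proof
    assume E: "\<forall>x\<in>{a..b}. edge x = 1 * x + 0"
    have "U a \<le> U z \<and> U z \<le> U b" if "z \<in> {a..b}" for z
      using mono[OF e[OF ab(2)], of z] mono[OF e[OF that], of b] E that ab by auto
    from this[OF assms(2)] this[OF assms(3)] show ?thesis by linarith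
  next
    assume E: "\<forall>x\<in>{a..b}. edge x = -1 * x + pi"
    have "U b \<le> U z \<and> U z \<le> U a" if "z \<in> {a..b}" for z
      using mono[OF e[OF ab(3)], of z] mono[OF e[OF that], of a] E that ab by auto
    from this[OF assms(2)] this[OF assms(3)] show ?thesis by linarith
  qed
qed

section \<open>Smoothness of the factors away from their singularities\<close>

lemma C2_on_edge: "one_sided c d \<Longrightarrow> C2_on c d edge"
  using edge_cases C2_on_cong[OF C2_on_linear] by blast

lemma C2_on_U:
  assumes "one_sided c d" "0 < c" "d < pi"
  shows "C2_on c d U"
  unfolding U_def[abs_def]
  by (rule C2_on_powr[OF C2_on_edge]) (use assms in \<open>auto simp: edge_def\<close>)

lemma C2_on_sinc_shift:
  assumes "0 \<le> c" "d \<le> pi"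
  shows "C2_on c d (\<lambda>x. sinc (x - s) powr \<gamma>)"
proof -
  have "C2_on c d (\<lambda>x. x - s)" using C2_on_linear[of c d 1 "- s"] by simp
  then show ?thesis
    using assms by (intro C2_on_powr C2_on_sinc sinc_shift_pos) auto
qed

lemma C2_on_f: "0 \<le> c \<Longrightarrow> d \<le> pi \<Longrightarrow> C2_on c d f"
  by (rule C2_on_subset[OF f])

lemma C2_on_G:
  assumes "one_sided c d"
  shows "C2_on c d G"
proof -
  have "0 \<le> c" "d \<le> pi" using assms pi_gt_zero unfolding one_sided_def by linarith+
  then show ?thesis
    unfolding G_def[abs_def] using assms
    by (intro C2_on_mult C2_on_f C2_on_sinc_shift C2_on_powr C2_on_sinc C2_on_edge sinc_edge_pos) auto
qed

lemma C2_on_V: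
  assumes "d < s \<or> s < c"
  shows "C2_on c d V"
  using assms
proof
  assume *: "d < s"
  have "C2_on c d (\<lambda>x. -1 * x + s)" by (rule C2_on_linear)
  then have "C2_on c d (\<lambda>x. (-1 * x + s) powr \<gamma>)" by (rule C2_on_powr) (use * in auto)
  then show ?thesis by (rule C2_on_cong) (use * in \<open>auto simp: V_def abs_if\<close>)
next
  assume *: "s < c"
  have "C2_on c d (\<lambda>x. 1 * x + - s)" by (rule C2_on_linear)
  then have "C2_on c d (\<lambda>x. (1 * x + - s) powr \<gamma>)" by (rule C2_on_powr) (use * in auto)
  then show ?thesis by (rule C2_on_cong) (use * in \<open>auto simp: V_def abs_if\<close>)
qed

text \<open>The sine is positive inside \<open>(0, pi)\<close>, so \<open>F\<close> is smooth even
  across \<open>pi / 2\<close>. This supplies one derivative of \<open>F\<close> for both sides of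
  \<open>s\<close>, also when \<open>s = pi / 2\<close>.\<close>

lemma C2_on_F:
  assumes "0 < c" "d < pi"
  shows "C2_on c d F"
proof -
  have "C2_on c d sin"
    by (rule C2_onI[where f' = cos and f'' = "\<lambda>x. - sin x"])
       (auto intro!: derivative_eq_intros continuous_intros)
  then have "C2_on c d (\<lambda>x. sin x powr \<beta>)"
    by (rule C2_on_powr) (use assms in \<open>auto intro!: sin_gt_zero\<close>)
  then show ?thesis
    unfolding F_def[abs_def] using assms by (intro C2_on_mult C2_on_f C2_on_sinc_shift) auto
qed

lemma F_continuous: "continuous_on {0..pi} F"
proof -
  have "continuous_on {0..pi} (\<lambda>x. sin x powr \<beta>)"
    using beta sin_ge_zero by (intro continuous_on_powr' continuous_intros) auto
  then show ?thesis
    unfolding F_def[abs_def]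
    by (intro continuous_on_mult C2_on_continuous_on[OF f] C2_on_continuous_on[OF C2_on_sinc_shift]) auto
qed

lemma FV_integrable: "(\<lambda>x. F x * V x) integrable_on {0..pi}"
  by (intro integrable_continuous_mult F_continuous V_integrable V_nonneg) auto

section \<open>Error on a single cell\<close>

text \<open>Here \<open>U\<close> is the weight and \<open>V\<close> the averaged factor: away from
  \<open>s\<close> the product of \<open>V\<close> and \<open>G\<close> is smooth up to the
  endpoints of \<open>[0, pi]\<close>, while of \<open>U\<close> only boundedness and monotonicity
  are used.\<close>

lemma cell_error_away:
  assumes "one_sided c d" "d < s \<or> s < c"
  obtains C where "C \<ge> 0"
    "\<And>a b. c \<le> a \<Longrightarrow> a < b \<Longrightarrow> b \<le> d \<Longrightarrow>
       \<bar>cell_error a b\<bar> \<le> C * (b - a)\<^sup>2 * ((b - a) + \<bar>U b - U a\<bar>)"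
proof -
  obtain P' A where A: "A \<ge> 0" "\<And>x. x \<in> {c..d} \<Longrightarrow> \<bar>P' x\<bar> \<le> A"
    "\<And>x y. x \<in> {c..d} \<Longrightarrow> y \<in> {c..d} \<Longrightarrow> \<bar>V y * G y - V x * G x - P' x * (y - x)\<bar> \<le> A * (y - x)\<^sup>2"
    using C2_on_Taylor[OF C2_on_mult[OF C2_on_V[OF assms(2)] C2_on_G[OF assms(1)]]] by metis
  obtain V' B where B: "B \<ge> 0"
    "\<And>x y. x \<in> {c..d} \<Longrightarrow> y \<in> {c..d} \<Longrightarrow> \<bar>V y - V x - V' x * (y - x)\<bar> \<le> B * (y - x)\<^sup>2"
    using C2_on_Taylor[OF C2_on_V[OF assms(2)]] by metis
  obtain D where D: "D \<ge> 0" "\<And>x. x \<in> {c..d} \<Longrightarrow> \<bar>G x\<bar> \<le> D"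
    using C2_on_bounded[OF C2_on_G[OF assms(1)]] by metis
  define E where "E = (A + D * B) * pi powr \<beta>"
  have E0: "E \<ge> 0" using A B D by (simp add: E_def)
  have "\<bar>cell_error a b\<bar> \<le> (E + A) * (b - a)\<^sup>2 * ((b - a) + \<bar>U b - U a\<bar>)"
    if ab: "c \<le> a" "a < b" "b \<le> d" for a b
  proof -
    let ?m = "(a + b) / 2" and ?h = "b - a"
    have one: "one_sided a b" using assms(1) ab by (auto simp: one_sided_def)
    have m: "?m \<in> {a..b}" "?m \<in> {c..d}" using ab by auto
    have bd: "0 \<le> x \<and> x \<le> pi" if "x \<in> {a..b}" for x using one_sided_bounds[OF one that] .
    have ab': "0 \<le> a" "b \<le> pi" using bd[of a] bd[of b] ab by auto
    have sub: "{a..b} \<subseteq> {c..d}" using ab by auto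
    have sq: "(x - ?m)\<^sup>2 \<le> ?h\<^sup>2" if "x \<in> {a..b}" for x
      using that by (intro power2_le_iff_abs_le[THEN iffD2]) (auto simp: abs_le_iff field_simps)
    have cP: "continuous_on {a..b} (\<lambda>x. V x * G x)"
      using continuous_on_subset[OF C2_on_continuous_on sub]
        C2_on_mult[OF C2_on_V[OF assms(2)] C2_on_G[OF assms(1)]] by blast
    define J where "J = integral {a..b} (\<lambda>x. (x - ?m) * U x)"
    define W where "W = integral {a..b} U"
    have "\<bar>integral {a..b} (\<lambda>x. (V x * G x) * U x)
        - 1 / ?h * G ?m * integral {a..b} U * integral {a..b} V
        - P' ?m * integral {a..b} (\<lambda>x. (x - ?m) * U x)\<bar>
      \<le> (A * ?h\<^sup>2 + D * (B * ?h\<^sup>2)) * integral {a..b} U"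
    proof (rule product_rule_error[where d = "V' ?m"])
      show "\<bar>V x * G x - V ?m * G ?m - P' ?m * (x - ?m)\<bar> \<le> A * ?h\<^sup>2" if "x \<in> {a..b}" for x
        using A(3)[OF m(2), of x] that sub mult_left_mono[OF sq[OF that] A(1)] by force
      show "\<bar>V x - V ?m - V' ?m * (x - ?m)\<bar> \<le> B * ?h\<^sup>2" if "x \<in> {a..b}" for x
        using B(2)[OF m(2), of x] that sub mult_left_mono[OF sq[OF that] B(1)] by force
    qed (use ab' ab m(2) D cP in \<open>auto intro: U_nonneg U_integrable V_integrable\<close>)
    moreover have "integral {a..b} (\<lambda>x. (V x * G x) * U x) = integral {a..b} (\<lambda>x. F x * V x)"
      by (intro integral_cong) (use bd F_eq in auto)
    ultimately have 1: "\<bar>cell_error a b - P' ?m * J\<bar> \<le> (A + D * B) * ?h\<^sup>2 * W"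
      by (simp add: cell_error_def algebra_simps J_def W_def)
    \<comment> \<open>The integral of the weight contributes a further factor \<open>h\<close>,
      which compensates for a number of cells of order 1/h.\<close>
    have "W \<le> integral {a..b} (\<lambda>_. pi powr \<beta>)"
      unfolding W_def using bd by (intro integral_le U_integrable ab' U_le) auto
    then have W: "W \<le> ?h * pi powr \<beta>" using ab by simp
    have "(A + D * B) * ?h\<^sup>2 * W \<le> (A + D * B) * ?h\<^sup>2 * (?h * pi powr \<beta>)"
      using W A(1) B(1) D(1) by (intro mult_left_mono) auto
    then have 2: "(A + D * B) * ?h\<^sup>2 * W \<le> E * ?h\<^sup>2 * ?h"
      by (simp add: E_def algebra_simps)
    \<comment> \<open>The first moment is bounded by the increment of \<open>U\<close>, not by a
      derivative, since for \<beta> < 1 the latter is unbounded at the endpoints.\<close>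
    have "\<bar>J\<bar> \<le> integral {a..b} (\<lambda>_. ?h * \<bar>U b - U a\<bar>)"
      unfolding J_def
    proof (rule first_moment_bound[where c = "U ?m"])
      show "\<bar>(x - ?m) * (U x - U ?m)\<bar> \<le> ?h * \<bar>U b - U a\<bar>" if "x \<in> {a..b}" for x
        unfolding abs_mult using that m U_between[OF one that m(1)]
        by (intro mult_mono) (auto simp: abs_le_iff field_simps)
    qed (use ab ab' in \<open>auto intro: U_nonneg U_integrable\<close>)
    then have "\<bar>J\<bar> \<le> ?h\<^sup>2 * \<bar>U b - U a\<bar>" using ab by (simp add: power2_eq_square)
    then have "\<bar>P' ?m * J\<bar> \<le> A * (?h\<^sup>2 * \<bar>U b - U a\<bar>)"
      unfolding abs_mult using A(1) A(2)[OF m(2)] by (intro mult_mono) auto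
    with 1 2 have "\<bar>cell_error a b\<bar> \<le> E * ?h\<^sup>2 * ?h + A * ?h\<^sup>2 * \<bar>U b - U a\<bar>"
      by (simp add: mult.assoc)
    also have "\<dots> \<le> E * ?h\<^sup>2 * (?h + \<bar>U b - U a\<bar>) + A * ?h\<^sup>2 * (?h + \<bar>U b - U a\<bar>)"
      using A(1) E0 ab by (intro add_mono mult_left_mono) auto
    finally show ?thesis by (simp add: algebra_simps)
  qed
  then show thesis using that[of "E + A"] E0 A(1) by auto
qed

text \<open>Now \<open>V\<close> is the weight, \<open>F\<close> is expanded, and \<open>U\<close>
  is averaged, for which \<open>U\<close> must be smooth on \<open>[c, d]\<close>. The derivative
  \<open>F'\<close> is passed in so that cells on both sides of \<open>pi / 2\<close> share
  it.\<close>

lemma cell_error_near: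
  assumes "one_sided c d" "0 < c" "d < pi" and A: "A \<ge> 0"
    "\<And>x y. x \<in> {c..d} \<Longrightarrow> y \<in> {c..d} \<Longrightarrow> \<bar>F y - F x - F' x * (y - x)\<bar> \<le> A * (y - x)\<^sup>2"
  obtains C where "C \<ge> 0"
    "\<And>a b. c \<le> a \<Longrightarrow> a < b \<Longrightarrow> b \<le> d \<Longrightarrow>
       \<bar>cell_error a b - F' ((a + b) / 2) * moment a b\<bar> \<le> C * (b - a)\<^sup>2 * integral {a..b} V"
proof -
  obtain U' B where B: "B \<ge> 0"
    "\<And>x y. x \<in> {c..d} \<Longrightarrow> y \<in> {c..d} \<Longrightarrow> \<bar>U y - U x - U' x * (y - x)\<bar> \<le> B * (y - x)\<^sup>2"
    using C2_on_Taylor[OF C2_on_U[OF assms(1-3)]] by metis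
  obtain D where D: "D \<ge> 0" "\<And>x. x \<in> {c..d} \<Longrightarrow> \<bar>G x\<bar> \<le> D"
    using C2_on_bounded[OF C2_on_G[OF assms(1)]] by metis
  have "\<bar>cell_error a b - F' ((a + b) / 2) * moment a b\<bar> \<le> (A + D * B) * (b - a)\<^sup>2 * integral {a..b} V"
    if ab: "c \<le> a" "a < b" "b \<le> d" for a b
  proof -
    let ?m = "(a + b) / 2" and ?h = "b - a"
    have m: "?m \<in> {c..d}" using ab by auto
    have ab': "0 \<le> a" "b \<le> pi" using ab assms by auto
    have sub: "{a..b} \<subseteq> {c..d}" using ab by auto
    have sq: "(x - ?m)\<^sup>2 \<le> ?h\<^sup>2" if "x \<in> {a..b}" for x
      using that by (intro power2_le_iff_abs_le[THEN iffD2]) (auto simp: abs_le_iff field_simps)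
    have "\<bar>integral {a..b} (\<lambda>x. F x * V x)
        - 1 / ?h * G ?m * integral {a..b} V * integral {a..b} U
        - F' ?m * integral {a..b} (\<lambda>x. (x - ?m) * V x)\<bar>
      \<le> (A * ?h\<^sup>2 + D * (B * ?h\<^sup>2)) * integral {a..b} V"
    proof (rule product_rule_error[where d = "U' ?m"])
      show "\<bar>F x - F ?m - F' ?m * (x - ?m)\<bar> \<le> A * ?h\<^sup>2" if "x \<in> {a..b}" for x
        using A(2)[OF m, of x] that sub mult_left_mono[OF sq[OF that] A(1)] by force
      show "\<bar>U x - U ?m - U' ?m * (x - ?m)\<bar> \<le> B * ?h\<^sup>2" if "x \<in> {a..b}" for x
        using B(2)[OF m, of x] that sub mult_left_mono[OF sq[OF that] B(1)] by force
      show "continuous_on {a..b} F"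
        by (rule continuous_on_subset[OF F_continuous]) (use ab' in auto)
      show "F ?m = U ?m * G ?m" using ab ab' by (intro F_eq) auto
    qed (use ab' ab m D in \<open>auto intro: V_nonneg U_integrable V_integrable\<close>)
    then show ?thesis by (simp add: cell_error_def moment_def algebra_simps)
  qed
  then show thesis using that[of "A + D * B"] A(1) B(1) D(1) by auto
qed

section \<open>Summation over all cells\<close>

lemma sum_U_variation_le:
  assumes "2 * real L * h = pi" "h > 0"
  shows "(\<Sum>n<2 * L. \<bar>U (h * (real n + 1)) - U (h * real n)\<bar>) \<le> 2 * U (pi / 2)"
proof -
  \<comment> \<open>Reflecting the decreasing branch of \<open>U\<close> makes the total variation a single telescoping sum.\<close>
  define T where "T x = (if x \<le> pi / 2 then U x else 2 * U (pi / 2) - U x)" for x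
  have mono: "U x \<le> U y" if "0 \<le> edge x" "edge x \<le> edge y" for x y
    unfolding U_def using that beta by (intro powr_mono2) auto
  have Lh: "h * real L = pi / 2" using assms by (simp add: field_simps)
  have "\<bar>U (h * (real n + 1)) - U (h * real n)\<bar> = T (h * real (Suc n)) - T (h * real n)"
    if "n < 2 * L" for n
  proof (cases "n < L")
    case True
    then have "real n + 1 \<le> real L" by linarith
    then have b: "h * (real n + 1) \<le> pi / 2"
      using mult_left_mono[of "real n + 1" "real L" h] assms Lh by simp
    have ab: "0 \<le> h * real n" "h * real n \<le> h * (real n + 1)" using assms by (auto intro!: mult_left_mono)
    have "U (h * real n) \<le> U (h * (real n + 1))"
      using ab b by (intro mono) (auto simp: edge_def)
    then show ?thesis using ab b by (simp add: T_def add.commute)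
  next
    case False
    then have "real L \<le> real n" "real n + 1 \<le> 2 * real L" using that by linarith+
    then have ab: "pi / 2 \<le> h * real n" "h * (real n + 1) \<le> pi" "h * real n < h * (real n + 1)"
      using mult_left_mono[of "real L" "real n" h] mult_left_mono[of "real n + 1" "2 * real L" h] assms Lh
      by (auto simp: algebra_simps)
    have "U (h * (real n + 1)) \<le> U (h * real n)"
      using ab by (intro mono) (auto simp: edge_def)
    moreover have "T (h * (real n + 1)) = 2 * U (pi / 2) - U (h * (real n + 1))"
      using ab by (simp add: T_def)
    \<comment> \<open>If \<open>h * real n = pi / 2\<close>, the first branch of \<open>T\<close>
      applies; both branches agree at that point.\<close>
    moreover have "T (h * real n) = 2 * U (pi / 2) - U (h * real n)"
      using ab by (auto simp: T_def intro!: arg_cong[where f = U])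
    ultimately show ?thesis by (simp add: add.commute)
  qed
  then have "(\<Sum>n<2 * L. \<bar>U (h * (real n + 1)) - U (h * real n)\<bar>)
      = (\<Sum>n<2 * L. T (h * real (Suc n)) - T (h * real n))" by simp
  also have "\<dots> = T (h * real (2 * L)) - T (h * real 0)"
    by (rule sum_lessThan_telescope)
  also have "\<dots> \<le> 2 * U (pi / 2)"
    using assms pi_gt_zero U_nonneg[of 0] U_nonneg[of pi] by (simp add: T_def mult.commute)
  finally show ?thesis .
qed

text \<open>The constant is fixed before the mesh. Cells far from \<open>s\<close> are bounded one
  by one; a cell near \<open>s\<close> leaves \<open>F'\<close> at its midpoint times its moment,
  and these terms are paired by reflection about \<open>s\<close>.\<close>

lemma cell_error_sum_bound:
  obtains K where "K \<ge> 0"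
    "\<And>h L \<sigma>. \<lbrakk>h > 0; 2 * real L * h = pi; s = h * real \<sigma>; 2 * h \<le> s; 2 * h \<le> pi - s\<rbrakk> \<Longrightarrow>
      \<bar>\<Sum>n<2 * L. cell_error (h * real n) (h * (real n + 1))\<bar> \<le> K * h\<^sup>2"
proof -
  \<comment> \<open>A cell counts as near when its midpoint is within \<open>\<delta> / 2\<close> of
    \<open>s\<close>. As \<open>h \<le> \<delta> / 2\<close>, half a cell is at most
    \<open>\<delta> / 4\<close>, so near cells lie within \<open>3 / 4 * \<delta>\<close> of
    \<open>s\<close> and all others stay at least \<open>\<delta> / 4\<close> away.\<close>
  define \<delta> where "\<delta> = min s (pi - s)"
  have \<delta>: "\<delta> > 0" "\<delta> \<le> s" "\<delta> \<le> pi - s" using s by (auto simp: \<delta>_def)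
  define lo hi where "lo = s - 3 / 4 * \<delta>" and "hi = s + 3 / 4 * \<delta>"
  have lohi: "0 < lo" "hi < pi" using \<delta> by (auto simp: lo_def hi_def)
  define IV where "IV = integral {0..pi} V"
  have IV: "IV \<ge> 0" unfolding IV_def by (intro integral_nonneg V_integrable) (auto simp: V_nonneg)
  \<comment> \<open>A single \<open>F'\<close> on the whole neighbourhood of \<open>s\<close>: its
    Lipschitz bound is applied to mirror midpoints, which may lie on different sides of
    \<open>pi / 2\<close>.\<close>
  obtain F' A where A: "A \<ge> 0"
    "\<And>x y. x \<in> {lo..hi} \<Longrightarrow> y \<in> {lo..hi} \<Longrightarrow> \<bar>F' y - F' x\<bar> \<le> A * \<bar>y - x\<bar>"
    "\<And>x y. x \<in> {lo..hi} \<Longrightarrow> y \<in> {lo..hi} \<Longrightarrow> \<bar>F y - F x - F' x * (y - x)\<bar> \<le> A * (y - x)\<^sup>2"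
    using C2_on_Taylor[OF C2_on_F[OF lohi]] by metis
  have near: "\<exists>C\<ge>0. \<forall>a b. c \<le> a \<longrightarrow> a < b \<longrightarrow> b \<le> d \<longrightarrow>
      \<bar>cell_error a b - F' ((a + b) / 2) * moment a b\<bar> \<le> C * (b - a)\<^sup>2 * integral {a..b} V"
    if one: "one_sided c d" and sub: "lo \<le> c" "d \<le> hi" for c d
  proof -
    have cd: "0 < c" "d < pi" using sub lohi by auto
    obtain C where "C \<ge> 0" "\<And>a b. c \<le> a \<Longrightarrow> a < b \<Longrightarrow> b \<le> d \<Longrightarrow>
       \<bar>cell_error a b - F' ((a + b) / 2) * moment a b\<bar> \<le> C * (b - a)\<^sup>2 * integral {a..b} V"
      by (rule cell_error_near[OF one cd A(1), of F']) (use A(3) sub in auto)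
    then show ?thesis by blast
  qed
  have away: "\<exists>C\<ge>0. \<forall>a b. c \<le> a \<longrightarrow> a < b \<longrightarrow> b \<le> d \<longrightarrow>
      \<bar>cell_error a b\<bar> \<le> C * (b - a)\<^sup>2 * ((b - a) + \<bar>U b - U a\<bar>)"
    if "one_sided c d" "d < s \<or> s < c" for c d
    using cell_error_away[OF that] by metis
  \<comment> \<open>Two intervals serve the near cells and four the far ones, each on one side of
    \<open>pi / 2\<close>. Depending on the position of \<open>s\<close> some are empty, and their
    bounds are then vacuous.\<close>
  have os: "one_sided lo (min hi (pi / 2))" "one_sided (max lo (pi / 2)) hi"
    "one_sided 0 (min (s - \<delta> / 4) (pi / 2))" "one_sided (max (s + \<delta> / 4) (pi / 2)) pi"
    "one_sided (pi / 2) (s - \<delta> / 4)" "one_sided (s + \<delta> / 4) (pi / 2)"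
    using lohi \<delta> pi_gt_zero unfolding one_sided_def by linarith+
  have avoid: "min (s - \<delta> / 4) (pi / 2) < s" "s < max (s + \<delta> / 4) (pi / 2)"
    "s - \<delta> / 4 < s" "s < s + \<delta> / 4"
    using \<delta> by linarith+
  obtain C1 where C1: "C1 \<ge> 0" "\<And>a b. lo \<le> a \<Longrightarrow> a < b \<Longrightarrow> b \<le> min hi (pi / 2) \<Longrightarrow>
      \<bar>cell_error a b - F' ((a + b) / 2) * moment a b\<bar> \<le> C1 * (b - a)\<^sup>2 * integral {a..b} V"
    using near[OF os(1) order_refl min.cobounded1] by blast
  obtain C2 where C2: "C2 \<ge> 0" "\<And>a b. max lo (pi / 2) \<le> a \<Longrightarrow> a < b \<Longrightarrow> b \<le> hi \<Longrightarrow>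
      \<bar>cell_error a b - F' ((a + b) / 2) * moment a b\<bar> \<le> C2 * (b - a)\<^sup>2 * integral {a..b} V"
    using near[OF os(2) max.cobounded1 order_refl] by blast
  obtain C3 where C3: "C3 \<ge> 0" "\<And>a b. 0 \<le> a \<Longrightarrow> a < b \<Longrightarrow> b \<le> min (s - \<delta> / 4) (pi / 2) \<Longrightarrow>
      \<bar>cell_error a b\<bar> \<le> C3 * (b - a)\<^sup>2 * ((b - a) + \<bar>U b - U a\<bar>)"
    using away[OF os(3) disjI1[OF avoid(1)]] by blast
  obtain C4 where C4: "C4 \<ge> 0" "\<And>a b. pi / 2 \<le> a \<Longrightarrow> a < b \<Longrightarrow> b \<le> s - \<delta> / 4 \<Longrightarrow>
      \<bar>cell_error a b\<bar> \<le> C4 * (b - a)\<^sup>2 * ((b - a) + \<bar>U b - U a\<bar>)"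
    using away[OF os(5) disjI1[OF avoid(3)]] by blast
  obtain C5 where C5: "C5 \<ge> 0" "\<And>a b. s + \<delta> / 4 \<le> a \<Longrightarrow> a < b \<Longrightarrow> b \<le> pi / 2 \<Longrightarrow>
      \<bar>cell_error a b\<bar> \<le> C5 * (b - a)\<^sup>2 * ((b - a) + \<bar>U b - U a\<bar>)"
    using away[OF os(6) disjI2[OF avoid(4)]] by blast
  obtain C6 where C6: "C6 \<ge> 0" "\<And>a b. max (s + \<delta> / 4) (pi / 2) \<le> a \<Longrightarrow> a < b \<Longrightarrow> b \<le> pi \<Longrightarrow>
      \<bar>cell_error a b\<bar> \<le> C6 * (b - a)\<^sup>2 * ((b - a) + \<bar>U b - U a\<bar>)"
    using away[OF os(4) disjI2[OF avoid(2)]] by blast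
  define C where "C = C1 + C2 + C3 + C4 + C5 + C6"
  note C0s = C1(1) C2(1) C3(1) C4(1) C5(1) C6(1)
  have C0: "C \<ge> 0" and Cge: "C1 \<le> C" "C2 \<le> C" "C3 \<le> C" "C4 \<le> C" "C5 \<le> C" "C6 \<le> C"
    using C0s by (auto simp: C_def)
  define M where "M = 1 + 2 * \<bar>\<gamma>\<bar> * 2 powr \<bar>\<gamma>\<bar>"
  have M0: "M \<ge> 0" by (simp add: M_def)
  define K where "K = C * (pi + 2 * U (pi / 2) + IV) + A * M * IV"
  have "\<bar>\<Sum>n<2 * L. cell_error (h * real n) (h * (real n + 1))\<bar> \<le> K * h\<^sup>2"
    if h: "h > 0" "2 * real L * h = pi" "s = h * real \<sigma>" "2 * h \<le> s" "2 * h \<le> pi - s" for h L \<sigma>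
  proof -
    have h\<delta>: "h \<le> \<delta> / 2" using h by (auto simp: \<delta>_def)
    define a where "a n = h * real n" for n
    define b where "b n = h * (real n + 1)" for n
    define m where "m n = (a n + b n) / 2" for n
    define W where "W n = integral {a n..b n} V" for n
    define \<omega> where "\<omega> n = \<bar>U (b n) - U (a n)\<bar>" for n
    define N where "N = {n. n < 2 * L \<and> \<bar>m n - s\<bar> < \<delta> / 2}"
    define c where "c n = F' (m n) * moment (a n) (b n)" for n
    have ba: "b n = a n + h" "b n - a n = h" "a n < b n" "0 \<le> a n" for n
      using h(1) by (auto simp: a_def b_def algebra_simps)
    have m: "m n = a n + h / 2" for n unfolding m_def ba by (simp add: field_simps)
    have le_a: "h * real k \<le> a n" if "k \<le> n" for k n
      unfolding a_def using that h(1) by (intro mult_left_mono) auto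
    have b_le: "b n \<le> h * real k" if "n < k" for k n
      unfolding b_def using that h(1) by (intro mult_left_mono) auto
    have bpi: "b n \<le> pi" if "n < 2 * L" for n
      using b_le[OF that] h(2) by (simp add: mult.commute)
    \<comment> \<open>\<open>pi / 2 = h * real L\<close> is a grid point, so no cell straddles the
      kink of \<open>U\<close>; the next fact is the analogue for \<open>s\<close>.\<close>
    have half: "b n \<le> pi / 2 \<or> pi / 2 \<le> a n" for n
    proof -
      have "h * real L = pi / 2" using h(2) by (simp add: field_simps)
      then show ?thesis using b_le[of n L] le_a[of L n] by linarith
    qed
    have side: "b n \<le> s \<or> s \<le> a n" for n
      using b_le[of n \<sigma>] le_a[of \<sigma> n] h(3) by linarith
    have W0: "W n \<ge> 0" if "n < 2 * L" for n
      unfolding W_def using bpi[OF that] ba(4) by (intro integral_nonneg V_integrable) (auto simp: V_nonneg)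
    have sub: "lo \<le> a n \<and> b n \<le> hi" if "n \<in> N" for n
      using that h\<delta> unfolding N_def m lo_def hi_def ba(1) mem_Collect_eq by linarith
    have mlohi: "m n \<in> {lo..hi}" if "n \<in> N" for n
      using sub[OF that] h(1) unfolding m by (auto simp: ba(1))
    have near_n: "\<bar>cell_error (a n) (b n) - c n\<bar> \<le> C * h\<^sup>2 * W n" if n: "n \<in> N" for n
    proof -
      have n2: "n < 2 * L" using n by (simp add: N_def)
      have "\<bar>cell_error (a n) (b n) - c n\<bar> \<le> max C1 C2 * h\<^sup>2 * W n"
      proof -
        have "\<bar>cell_error (a n) (b n) - c n\<bar> \<le> C1 * h\<^sup>2 * W n \<or> \<bar>cell_error (a n) (b n) - c n\<bar> \<le> C2 * h\<^sup>2 * W n"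
          using half[of n] sub[OF n] C1(2)[of "a n" "b n"] C2(2)[of "a n" "b n"] ba(3)[of n]
          unfolding c_def m_def W_def ba(2) by auto
        moreover have "C1 * h\<^sup>2 * W n \<le> max C1 C2 * h\<^sup>2 * W n" "C2 * h\<^sup>2 * W n \<le> max C1 C2 * h\<^sup>2 * W n"
          using W0[OF n2] by (auto intro!: mult_right_mono)
        ultimately show ?thesis by linarith
      qed
      also have "\<dots> \<le> C * h\<^sup>2 * W n" using W0[OF n2] Cge by (intro mult_right_mono) auto
      finally show ?thesis .
    qed
    have away_n: "\<bar>cell_error (a n) (b n)\<bar> \<le> C * h\<^sup>2 * (h + \<omega> n)" if n: "n < 2 * L" "n \<notin> N" for n
    proof -
      have far: "b n \<le> s - \<delta> / 4 \<or> s + \<delta> / 4 \<le> a n"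
        using n side[of n] h\<delta> h(1) unfolding N_def m ba(1) by auto
      have nn: "h\<^sup>2 * (h + \<omega> n) \<ge> 0" using h(1) by (simp add: \<omega>_def)
      have "\<exists>D\<in>{C3, C4, C5, C6}. \<bar>cell_error (a n) (b n)\<bar> \<le> D * h\<^sup>2 * (h + \<omega> n)"
        using far half[of n] C3(2)[of "a n" "b n"] C4(2)[of "a n" "b n"] C5(2)[of "a n" "b n"] C6(2)[of "a n" "b n"]
          ba(3,4)[of n] bpi[OF n(1)]
        unfolding \<omega>_def ba(2) by auto
      then obtain D where D: "D \<in> {C3, C4, C5, C6}" "\<bar>cell_error (a n) (b n)\<bar> \<le> D * h\<^sup>2 * (h + \<omega> n)" by blast
      have "D \<le> C" using D(1) Cge by auto
      then have "D * (h\<^sup>2 * (h + \<omega> n)) \<le> C * (h\<^sup>2 * (h + \<omega> n))" using nn by (rule mult_right_mono)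
      with D(2) show ?thesis by (simp add: mult.assoc)
    qed
    \<comment> \<open>One bound for both kinds of cells; the sums of \<open>h\<close>,
      \<open>\<omega> n\<close> and \<open>W n\<close> over all cells are bounded independently of
      \<open>h\<close>.\<close>
    have each: "\<bar>cell_error (a n) (b n) - (if n \<in> N then c n else 0)\<bar> \<le> C * h\<^sup>2 * (h + \<omega> n + W n)"
      if n: "n < 2 * L" for n
    proof -
      have "0 \<le> \<omega> n" by (simp add: \<omega>_def)
      then have "C * h\<^sup>2 * W n \<le> C * h\<^sup>2 * (h + \<omega> n + W n)" "C * h\<^sup>2 * (h + \<omega> n) \<le> C * h\<^sup>2 * (h + \<omega> n + W n)"
        using C0 W0[OF n] h(1) by (auto intro!: mult_left_mono)
      then show ?thesis using near_n[of n] away_n[OF n] by (cases "n \<in> N") auto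
    qed
    have Nsub: "N \<subseteq> {..<2 * L}" by (auto simp: N_def)
    have finN: "finite N" using Nsub finite_subset by blast
    have sumW: "(\<Sum>n<2 * L. W n) = IV"
      using sum_integral_cells[of V h "2 * L"] V_integrable[of 0 pi] h(1,2)
      by (simp add: W_def a_def b_def IV_def mult.commute)
    have sum\<omega>: "(\<Sum>n<2 * L. \<omega> n) \<le> 2 * U (pi / 2)"
      unfolding \<omega>_def a_def b_def by (rule sum_U_variation_le[OF h(2,1)])
    have "\<bar>(\<Sum>n<2 * L. cell_error (a n) (b n)) - (\<Sum>n\<in>N. c n)\<bar>
        = \<bar>\<Sum>n<2 * L. cell_error (a n) (b n) - (if n \<in> N then c n else 0)\<bar>"
      using Nsub by (simp add: sum_subtractf sum.If_cases Int_absorb1)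
    also have "\<dots> \<le> (\<Sum>n<2 * L. C * h\<^sup>2 * (h + \<omega> n + W n))"
      by (rule order_trans[OF sum_abs sum_mono]) (use each in auto)
    also have "\<dots> = C * h\<^sup>2 * ((2 * real L * h) + (\<Sum>n<2 * L. \<omega> n) + (\<Sum>n<2 * L. W n))"
      by (simp add: sum.distrib flip: sum_distrib_left)
    also have "\<dots> \<le> C * h\<^sup>2 * (pi + 2 * U (pi / 2) + IV)"
      unfolding sumW h(2) using sum\<omega> C0 by (intro mult_left_mono) auto
    finally have 1: "\<bar>(\<Sum>n<2 * L. cell_error (a n) (b n)) - (\<Sum>n\<in>N. c n)\<bar>
        \<le> C * h\<^sup>2 * (pi + 2 * U (pi / 2) + IV)" .
    \<comment> \<open>The index of the mirror image about \<open>s\<close> of the \<open>n\<close>-th cell.\<close>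
    define R where "R n = 2 * \<sigma> - 1 - n" for n
    have refl: "n < 2 * \<sigma> \<and> R n \<in> N \<and> R (R n) = n \<and> a (R n) = 2 * s - b n \<and> b (R n) = 2 * s - a n"
      if n: "n \<in> N" for n
    proof -
      \<comment> \<open>The mirror midpoint is still inside \<open>(0, pi)\<close>. Dividing by
        \<open>h\<close> and using integrality puts the mirror index in range and shows that the
        subtraction in \<open>R\<close> is not truncated.\<close>
      have "0 < 2 * s - m n" "2 * s - m n < pi"
        using n \<delta> unfolding N_def mem_Collect_eq by linarith+
      then have "0 < h * (2 * real \<sigma> - real n - 1 / 2)" "h * (2 * real \<sigma> - real n - 1 / 2) < h * (2 * real L)"
        unfolding m a_def h(3) using h(2) by (auto simp: algebra_simps)
      then have "real n + 1 / 2 < 2 * real \<sigma>" "2 * real \<sigma> - real n - 1 / 2 < 2 * real L"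
        using h(1) by (auto simp: zero_less_mult_iff)
      then have lt: "n < 2 * \<sigma>" and lt2: "2 * \<sigma> - 1 - n < 2 * L" by linarith+
      have r: "real (R n) = 2 * real \<sigma> - 1 - real n" using lt unfolding R_def by linarith
      have ab: "a (R n) = 2 * s - b n" "b (R n) = 2 * s - a n"
        unfolding a_def b_def r h(3) by (auto simp: algebra_simps)
      have "m (R n) - s = s - m n" unfolding m_def ab by (simp add: field_simps)
      then show ?thesis using n lt lt2 ab by (auto simp: N_def R_def abs_minus_commute)
    qed
    have cR: "c n + c (R n) = (F' (m n) - F' (2 * s - m n)) * moment (a n) (b n)" if "n \<in> N" for n
    proof -
      have ab: "a (R n) = 2 * s - b n" "b (R n) = 2 * s - a n" using refl[OF that] by auto
      have mom: "moment (a (R n)) (b (R n)) = - moment (a n) (b n)"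
        unfolding ab moment_def V_def by (rule first_moment_dist_powr_reflect)
      have mR: "m (R n) = 2 * s - m n" unfolding m_def ab by (simp add: field_simps)
      show ?thesis unfolding c_def mom mR by (simp add: left_diff_distrib)
    qed
    have pair: "\<bar>c n + c (R n)\<bar> \<le> 2 * A * M * h\<^sup>2 * W n" if n: "n \<in> N" for n
    proof -
      have "2 * s - m n = m (R n)" unfolding m_def using refl[OF n] by (simp add: field_simps)
      \<comment> \<open>The Lipschitz bound at mirror midpoints yields the factor
        \<open>\<bar>m n - s\<bar>\<close> that the moment estimate needs.\<close>
      then have "\<bar>F' (m n) - F' (2 * s - m n)\<bar> \<le> A * \<bar>m n - (2 * s - m n)\<bar>"
        using A(2)[of "2 * s - m n" "m n"] mlohi[OF n] mlohi[of "R n"] refl[OF n] by auto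
      also have "\<bar>m n - (2 * s - m n)\<bar> = 2 * \<bar>m n - s\<bar>" by (simp add: abs_if)
      finally have "\<bar>c n + c (R n)\<bar> \<le> A * (2 * \<bar>m n - s\<bar>) * \<bar>moment (a n) (b n)\<bar>"
        unfolding cR[OF n] abs_mult by (rule mult_right_mono) simp
      also have "\<dots> = 2 * A * (\<bar>m n - s\<bar> * \<bar>moment (a n) (b n)\<bar>)" by simp
      also have "\<dots> \<le> 2 * A * (M * h\<^sup>2 * W n)"
      proof (rule mult_left_mono)
        \<comment> \<open>Since \<open>s\<close> is a grid point, a cell without an end at
          \<open>s\<close> is separated from it by at least one whole cell.\<close>
        have "a n = s \<or> b n = s \<or> b n - a n \<le> \<bar>a n - s\<bar> \<and> b n - a n \<le> \<bar>b n - s\<bar>"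
        proof -
          consider "\<sigma> \<le> n" | "Suc n = \<sigma>" | "Suc n < \<sigma>" by linarith
          then show ?thesis
          proof cases
            case 1
            then consider "n = \<sigma>" | "Suc \<sigma> \<le> n" by linarith
            then show ?thesis
            proof cases
              case 1
              then show ?thesis by (simp add: a_def h(3))
            next
              case 2
              have "s + h \<le> a n" using le_a[OF 2] h(3) by (simp add: algebra_simps)
              then show ?thesis using ba(2,3)[of n] h(1) by linarith
            qed
          next
            case 2
            then show ?thesis by (auto simp: b_def h(3))
          next
            case 3
            have "b (Suc n) \<le> s" using b_le[OF 3] h(3) by simp
            moreover have "b (Suc n) = b n + h" by (simp add: b_def algebra_simps)
            ultimately show ?thesis using ba(2,3)[of n] h(1) by linarith
          qed
        qed
        from first_moment_dist_powr_bound[OF ba(3) gamma side this]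
        show "\<bar>m n - s\<bar> * \<bar>moment (a n) (b n)\<bar> \<le> M * h\<^sup>2 * W n"
          unfolding m_def moment_def V_def[abs_def] M_def W_def ba(2) .
      qed (use A(1) in simp)
      finally show ?thesis by (simp add: mult.assoc)
    qed
    \<comment> \<open>\<open>R\<close> is an involution of \<open>N\<close>, so the sum over pairs
      counts every term twice.\<close>
    have "(\<Sum>n\<in>N. c n) = (\<Sum>n\<in>N. c (R n))"
      by (rule sum.reindex_bij_witness[where i = R and j = R]) (use refl in auto)
    then have "2 * \<bar>\<Sum>n\<in>N. c n\<bar> = \<bar>\<Sum>n\<in>N. c n + c (R n)\<bar>"
      by (simp add: sum.distrib)
    also have "\<dots> \<le> (\<Sum>n\<in>N. 2 * A * M * h\<^sup>2 * W n)"
      by (rule order_trans[OF sum_abs sum_mono]) (use pair in auto)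
    also have "\<dots> \<le> (\<Sum>n<2 * L. 2 * A * M * h\<^sup>2 * W n)"
      using Nsub W0 A(1) M0 by (intro sum_mono2) auto
    also have "\<dots> = 2 * (A * M * h\<^sup>2 * IV)"
      unfolding sumW[symmetric] by (simp add: sum_distrib_left mult.assoc)
    finally have 2: "\<bar>\<Sum>n\<in>N. c n\<bar> \<le> A * M * h\<^sup>2 * IV" by simp
    have "\<bar>\<Sum>n<2 * L. cell_error (a n) (b n)\<bar>
        \<le> C * h\<^sup>2 * (pi + 2 * U (pi / 2) + IV) + A * M * h\<^sup>2 * IV"
      using 1 2 by linarith
    also have "\<dots> = K * h\<^sup>2" by (simp add: K_def algebra_simps)
    finally show ?thesis by (simp add: a_def b_def)
  qed
  moreover have "K \<ge> 0"
    unfolding K_def using C0 IV A(1) M0 U_nonneg[of "pi / 2"] by (intro add_nonneg_nonneg mult_nonneg_nonneg) auto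
  ultimately show thesis using that by blast
qed

end

section \<open>Identification with the quadrature formula and uniformity\<close>

text \<open>As \<open>s\<close> is a grid point, every cell lies on one side of it and no midpoint
  equals it. The differences of powers in the rule are therefore the exact integrals of
  \<open>U\<close> and \<open>V\<close>, and the sine quotients are values of
  \<open>sinc\<close>.\<close>

lemma quad_error_eq_sum_cell_error:
  assumes "singular_product \<beta> \<gamma> (colloc_point N j) f" "r \<ge> 1" "N \<ge> 1"
    and grid: "colloc_point N j = mesh_width N r * real \<sigma>"
  shows "quad_error \<beta> \<gamma> f N r j =
    (\<Sum>n<2 * (r * N). singular_product.cell_error \<beta> \<gamma> (colloc_point N j) f
      (mesh_width N r * real n) (mesh_width N r * (real n + 1)))"
proof -
  define s where "s = colloc_point N j"
  interpret singular_product \<beta> \<gamma> s f using assms(1) by (simp add: s_def)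
  define h where "h = mesh_width N r"
  define L where "L = r * N"
  \<comment> \<open>Common form of the summands of both halves, which differ only in the branch of
    \<open>edge\<close>.\<close>
  define cell_rule where "cell_rule n = 1 / h * G (h * (real n + 1 / 2))
    * integral {h * real n..h * (real n + 1)} U * integral {h * real n..h * (real n + 1)} V" for n
  have h: "h > 0" "2 * real L * h = pi" using assms by (auto simp: h_def L_def mesh_width_def)
  have Lh: "h * real L = pi / 2" using h(2) by (simp add: field_simps)
  have side: "h * (real n + 1) \<le> s \<or> s \<le> h * real n" for n
  proof (cases "n < \<sigma>")
    case True
    then have "real n + 1 \<le> real \<sigma>" by linarith
    then have "h * (real n + 1) \<le> h * real \<sigma>" using h(1) by (intro mult_left_mono) auto
    then show ?thesis using grid by (simp add: s_def h_def)
  next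
    case False
    then show ?thesis using h(1) grid by (simp add: s_def h_def)
  qed
  have mids: "h * (real n + 1 / 2) \<noteq> s" "h * real n < h * (real n + 1 / 2)"
    "h * (real n + 1 / 2) < h * (real n + 1)" for n
    using side[of n] h(1) by (auto simp: algebra_simps)
  have V: "integral {h * real n..h * (real n + 1)} V = (sgn (h * (real n + 1) - s) * \<bar>h * (real n + 1) - s\<bar> powr (\<gamma> + 1)
      - sgn (h * real n - s) * \<bar>h * real n - s\<bar> powr (\<gamma> + 1)) / (\<gamma> + 1)" for n
    using V_has_integral[OF _ side[of n]] h(1) by (intro integral_unique) auto
  have left: "quad_left \<beta> \<gamma> f N r j = (\<Sum>n = 0..<L. cell_rule n)"
    unfolding quad_left_def Let_def mesh_point_def sum_distrib_left L_def[symmetric] h_def[symmetric] s_def[symmetric]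
  proof (rule sum.cong[OF refl])
    fix n assume "n \<in> {0..<L}"
    then have "real n + 1 \<le> real L" by auto
    then have b: "h * (real n + 1) \<le> pi / 2" using h(1) Lh by (metis mult_left_mono less_imp_le)
    have U: "integral {h * real n..h * (real n + 1)} U
        = ((h * (real n + 1)) powr (\<beta> + 1) - (h * real n) powr (\<beta> + 1)) / (\<beta> + 1)"
      using U_has_integral_left[OF _ _ b] h(1) by (intro integral_unique) auto
    have m0: "h * (real n + 1 / 2) \<noteq> 0" using h(1) by auto
    have e: "edge (h * (real n + 1 / 2)) = h * (real n + 1 / 2)"
      using mids[of n] b unfolding edge_def by linarith
    show "1 / h * ((sin (h * (real n + 1 / 2)) / (h * (real n + 1 / 2))) powr \<beta> *
          (sin (h * (real n + 1 / 2) - s) / (h * (real n + 1 / 2) - s)) powr \<gamma> *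
          (((h * (real n + 1)) powr (\<beta> + 1) - (h * real n) powr (\<beta> + 1)) / (\<beta> + 1)) *
          ((sgn (h * (real n + 1) - s) * \<bar>h * (real n + 1) - s\<bar> powr (\<gamma> + 1) -
            sgn (h * real n - s) * \<bar>h * real n - s\<bar> powr (\<gamma> + 1)) / (\<gamma> + 1)) *
          f (h * (real n + 1 / 2))) = cell_rule n"
      unfolding cell_rule_def U V G_def e using m0 mids(1)[of n] by (simp add: sinc_def mult_ac)
  qed
  have right: "quad_right \<beta> \<gamma> f N r j = (\<Sum>n = L..<2 * L. cell_rule n)"
    unfolding quad_right_def Let_def mesh_point_def sum_distrib_left mult.assoc[of 2 r N] L_def[symmetric] h_def[symmetric] s_def[symmetric]
  proof (rule sum.cong[OF refl])
    fix n assume n: "n \<in> {L..<2 * L}"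
    then have "real L \<le> real n" "real n + 1 \<le> 2 * real L" by auto
    then have ab: "pi / 2 \<le> h * real n" "h * (real n + 1) \<le> pi"
      using mult_left_mono[of "real L" "real n" h] mult_left_mono[of "real n + 1" "2 * real L" h] h Lh
      by (auto simp: algebra_simps)
    have U: "integral {h * real n..h * (real n + 1)} U
        = ((pi - h * real n) powr (\<beta> + 1) - (pi - h * (real n + 1)) powr (\<beta> + 1)) / (\<beta> + 1)"
      using U_has_integral_right[OF ab(1) _ ab(2)] h(1) by (intro integral_unique) auto
    have e: "edge (h * (real n + 1 / 2)) = pi - h * (real n + 1 / 2)" and m0: "pi - h * (real n + 1 / 2) \<noteq> 0"
      using mids[of n] ab unfolding edge_def by linarith+
    show "1 / h * ((sin (h * (real n + 1 / 2)) / (pi - h * (real n + 1 / 2))) powr \<beta> *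
          (sin (h * (real n + 1 / 2) - s) / (h * (real n + 1 / 2) - s)) powr \<gamma> *
          (((pi - h * real n) powr (\<beta> + 1) - (pi - h * (real n + 1)) powr (\<beta> + 1)) / (\<beta> + 1)) *
          ((sgn (h * (real n + 1) - s) * \<bar>h * (real n + 1) - s\<bar> powr (\<gamma> + 1) -
            sgn (h * real n - s) * \<bar>h * real n - s\<bar> powr (\<gamma> + 1)) / (\<gamma> + 1)) *
          f (h * (real n + 1 / 2))) = cell_rule n"
      unfolding cell_rule_def U V G_def e using m0 mids(1)[of n] by (simp add: sinc_def mult_ac)
  qed
  have "sing_integral \<beta> \<gamma> f s = integral {0..pi} (\<lambda>x. F x * V x)"
    unfolding sing_integral_def by (intro integral_cong) (use FV_eq in auto)
  also have "\<dots> = (\<Sum>n<2 * L. integral {h * real n..h * (real n + 1)} (\<lambda>x. F x * V x))"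
    using sum_integral_cells[of "\<lambda>x. F x * V x" h "2 * L"] FV_integrable h by (simp add: mult.commute)
  finally have sing: "sing_integral \<beta> \<gamma> f s
    = (\<Sum>n<2 * L. integral {h * real n..h * (real n + 1)} (\<lambda>x. F x * V x))" .
  have "(\<Sum>n = 0..<L. cell_rule n) + (\<Sum>n = L..<2 * L. cell_rule n) = (\<Sum>n = 0..<2 * L. cell_rule n)"
    by (rule sum.atLeastLessThan_concat) auto
  then have "quad_error \<beta> \<gamma> f N r j
      = (\<Sum>n<2 * L. integral {h * real n..h * (real n + 1)} (\<lambda>x. F x * V x) - cell_rule n)"
    unfolding quad_error_def left right s_def[symmetric] sing
    by (simp add: sum_subtractf atLeast0LessThan algebra_simps)
  also have "\<dots> = (\<Sum>n<2 * L. cell_error (h * real n) (h * (real n + 1)))"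
  proof (rule sum.cong[OF refl])
    fix n
    have "(h * real n + h * (real n + 1)) / 2 = h * (real n + 1 / 2)" "h * (real n + 1) - h * real n = h"
      by (auto simp: field_simps)
    then show "integral {h * real n..h * (real n + 1)} (\<lambda>x. F x * V x) - cell_rule n = cell_error (h * real n) (h * (real n + 1))"
      by (simp add: cell_error_def cell_rule_def)
  qed
  finally show ?thesis by (simp add: h_def L_def s_def)
qed

text \<open>The collocation point is the grid point with index \<open>(2 * j + 1) * r\<close> and
  has at least \<open>r\<close> cells on either side, so from \<open>r = 2\<close> on it is at least
  two cells away from both endpoints.\<close>

lemma quad_error_bound_at_collocation_point:
  assumes "C2_on 0 pi f" "\<beta> > 0" "\<gamma> > -1" "j < N"
  shows "\<exists>K\<ge>0. \<forall>r\<ge>1. \<bar>quad_error \<beta> \<gamma> f N r j\<bar> \<le> K / (real r)\<^sup>2"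
proof -
  define s where "s = colloc_point N j"
  have N: "N \<ge> 1" and jN: "real j + 1 \<le> real N" using assms(4) by auto
  have mesh: "mesh_width N r * (2 * real r * real N) = pi" "mesh_width N r > 0"
    "s = mesh_width N r * real ((2 * j + 1) * r)" if "r \<ge> 1" for r
    using that N by (auto simp: s_def mesh_width_def colloc_point_def field_simps)
  have s_bounds: "mesh_width N r * real r \<le> s" "mesh_width N r * real r \<le> pi - s" if "r \<ge> 1" for r
  proof -
    have "real r * (2 * real j + 1) \<ge> real r * 1" by (intro mult_left_mono) auto
    moreover have "real r * (2 * real j + 1) + real r * 1 \<le> real r * (2 * real N)"
      using mult_left_mono[of "2 * real j + 1 + 1" "2 * real N" "real r"] jN by (simp add: distrib_left)
    ultimately have *: "real r \<le> real ((2 * j + 1) * r)" "real ((2 * j + 1) * r) + real r \<le> 2 * real r * real N"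
      by (auto simp: algebra_simps)
    then show "mesh_width N r * real r \<le> s"
      using mesh[OF that] by simp
    have "mesh_width N r * (real ((2 * j + 1) * r) + real r) \<le> mesh_width N r * (2 * real r * real N)"
      using * mesh[OF that] by (intro mult_left_mono) auto
    moreover have "mesh_width N r * (real ((2 * j + 1) * r) + real r) = s + mesh_width N r * real r"
      unfolding mesh(3)[OF that] by (rule distrib_left)
    ultimately show "mesh_width N r * real r \<le> pi - s"
      using mesh(1)[OF that] by linarith
  qed
  have "0 < s" "s < pi" using s_bounds[of 1] mesh(2)[of 1] by auto
  then interpret singular_product \<beta> \<gamma> s f by unfold_locales (use assms in auto)
  obtain K where K: "K \<ge> 0"
    "\<And>h L \<sigma>. \<lbrakk>h > 0; 2 * real L * h = pi; s = h * real \<sigma>; 2 * h \<le> s; 2 * h \<le> pi - s\<rbrakk> \<Longrightarrow>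
      \<bar>\<Sum>n<2 * L. cell_error (h * real n) (h * (real n + 1))\<bar> \<le> K * h\<^sup>2"
    using cell_error_sum_bound by blast
  \<comment> \<open>For \<open>r = 1\<close> the cells touching \<open>s\<close> may reach an endpoint, so this case is absorbed into the constant.\<close>
  define K1 where "K1 = K * (pi / (2 * real N))\<^sup>2 + \<bar>quad_error \<beta> \<gamma> f N 1 j\<bar>"
  have "\<bar>quad_error \<beta> \<gamma> f N r j\<bar> \<le> K1 / (real r)\<^sup>2" if r: "r \<ge> 1" for r
  proof (cases "r = 1")
    case True
    then show ?thesis using K(1) by (simp add: K1_def)
  next
    case False
    then have "mesh_width N r * 2 \<le> mesh_width N r * real r"
      using r mesh(2)[OF r] by (intro mult_left_mono) auto
    then have "2 * mesh_width N r \<le> s" "2 * mesh_width N r \<le> pi - s"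
      using s_bounds[OF r] by linarith+
    moreover have "2 * real (r * N) * mesh_width N r = pi"
      using mesh(1)[OF r] by (simp add: mult.commute mult.left_commute)
    moreover have "quad_error \<beta> \<gamma> f N r j
        = (\<Sum>n<2 * (r * N). cell_error (mesh_width N r * real n) (mesh_width N r * (real n + 1)))"
      using quad_error_eq_sum_cell_error[of \<beta> \<gamma> N j f r "(2 * j + 1) * r"] mesh(3)[OF r] r N
        singular_product_axioms by (simp add: s_def)
    ultimately have "\<bar>quad_error \<beta> \<gamma> f N r j\<bar> \<le> K * (mesh_width N r)\<^sup>2"
      using K(2)[of "mesh_width N r" "r * N" "(2 * j + 1) * r"] mesh(2,3)[OF r] by simp
    also have "\<dots> = K * (pi / (2 * real N))\<^sup>2 / (real r)\<^sup>2"
      by (simp add: mesh_width_def power_divide power_mult_distrib)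
    also have "\<dots> \<le> K1 / (real r)\<^sup>2"
      by (intro divide_right_mono) (auto simp: K1_def)
    finally show ?thesis .
  qed
  moreover have "K1 \<ge> 0" using K(1) by (simp add: K1_def)
  ultimately show ?thesis by blast
qed

theorem theorem2:
  fixes f :: "real \<Rightarrow> real" and \<beta> \<gamma> :: real and N :: nat
  assumes "C2_on 0 pi f"
    and "\<beta> > 0"
    and "\<gamma> > -1"
    and "N \<ge> 1"
  shows "\<exists>K>0. \<forall>r\<ge>1. \<forall>j<N. \<bar>quad_error \<beta> \<gamma> f N r j\<bar> \<le> K / (real r)\<^sup>2"
proof -
  have "\<forall>j. \<exists>K. j < N \<longrightarrow> K \<ge> 0 \<and> (\<forall>r\<ge>1. \<bar>quad_error \<beta> \<gamma> f N r j\<bar> \<le> K / (real r)\<^sup>2)"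
    using quad_error_bound_at_collocation_point[OF assms(1-3)] by blast
  then obtain K where K: "\<And>j. j < N \<Longrightarrow> K j \<ge> 0"
    "\<And>j r. j < N \<Longrightarrow> r \<ge> 1 \<Longrightarrow> \<bar>quad_error \<beta> \<gamma> f N r j\<bar> \<le> K j / (real r)\<^sup>2"
    by metis
  \<comment> \<open>The finitely many nonnegative constants are dominated by their sum; adding 1
    makes the common constant strictly positive.\<close>
  have "\<bar>quad_error \<beta> \<gamma> f N r j\<bar> \<le> (1 + (\<Sum>i<N. K i)) / (real r)\<^sup>2" if "r \<ge> 1" "j < N" for r j
  proof -
    have "K j \<le> (\<Sum>i<N. K i)" using K(1) that by (intro member_le_sum) auto
    then have "K j / (real r)\<^sup>2 \<le> (1 + (\<Sum>i<N. K i)) / (real r)\<^sup>2"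
      by (intro divide_right_mono) auto
    with K(2)[OF that(2,1)] show ?thesis by linarith
  qed
  moreover have "1 + (\<Sum>i<N. K i) > 0"
    using K(1) by (intro add_pos_nonneg sum_nonneg) auto
  ultimately show ?thesis by blast
qed

end
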